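(* Let $\mathcal{A}$ be a dual Banach algebra. If $\mathcal{A}$ is Johnson pseudo-Connes amenable, then $\mathcal{A}$ is strong pseudo-Connes amenable.
   Context: A Banach algebra $\mathcal{A}$ is a dual Banach algebra if there is a closed submodule $\mathcal{A}_*$ of the dual bimodule $\mathcal{A}^*$ with $\mathcal{A}=(\mathcal{A}_* )^*$; the $wk^*$-topology on $\mathcal{A}$ is $\sigma(\mathcal{A},\mathcal{A}_* )$. For a Banach $\mathcal{A}$-bimodule $E$, $\sigma wc(E)$ is the closed submodule of all $x\in E$ such that the maps $\mathcal{A}\to E$, $a\mapsto a\cdot x$ and $a\mapsto x\cdot a$, are $wk^*$-$wk$-continuous. The projective tensor product $\mathcal{A}\hat\otimes\mathcal{A}$ is an $\mathcal{A}$-bimodule via $a\cdot(b\otimes c)=ab\otimes c$, $(b\otimes c)\cdot a=b\otimes ca$; duals carry the dual module actions. Write $\sigma wc(\mathcal{A}\hat\otimes\mathcal{A})^*$ for $\sigma wc((\mathcal{A}\hat\otimes\mathcal{A})^* )$. Let $\pi=\pi_{\mathcal{A}}:\mathcal{A}\hat\otimes\mathcal{A}\to\mathcal{A}$, $\pi(a\otimes b)=ab$. Then $\pi^*$ maps $\mathcal{A}_*$ into $\sigma wc(\mathcal{A}\hat\otimes\mathcal{A})^*$, and $\pi_{\sigma wc}:(\sigma wc(\mathcal{A}\hat\otimes\mathcal{A})^* )^*\to\mathcal{A}$ denotes the adjoint of $\pi^*|_{\mathcal{A}_*}$; it is an $\mathcal{A}$-bimodule morphism. $\mathcal{A}$ is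 strong pseudo-Connes amenable if there is a (not necessarily bounded) net $(m_\alpha)$ in $(\sigma wc(\mathcal{A}\hat\otimes\mathcal{A})^* )^*$ such that for every $a\in\mathcal{A}$: (i) $a\cdot m_\alpha-m_\alpha\cdot a\to0$ in the $wk^*$-topology of $(\sigma wc(\mathcal{A}\hat\otimes\mathcal{A})^* )^*$; (ii) $a\,\pi_{\sigma wc}(m_\alpha)=\pi_{\sigma wc}(m_\alpha)\,a$ for all $\alpha$, and $a\,\pi_{\sigma wc}(m_\alpha)\to a$ in the $wk^*$-topology of $\mathcal{A}$. $\mathcal{A}$ is Johnson pseudo-Connes amenable if there is a (not necessarily bounded) net $(m_\alpha)$ in $(\mathcal{A}\hat\otimes\mathcal{A})^{**}$ such that $\langle T,a\cdot m_\alpha\rangle=\langle T,m_\alpha\cdot a\rangle$ for all $\alpha$ and $i_{\mathcal{A}_*}^*\pi_{\mathcal{A}}^{**}(m_\alpha)a\to a$ in norm, for every $a\in\mathcal{A}$ and $T\in\sigma wc(\mathcal{A}\hat\otimes\mathcal{A})^*$, where $i_{\mathcal{A}_*}:\mathcal{A}_*\hookrightarrow\mathcal{A}^*$ is the canonical embedding (so $i_{\mathcal{A}_*}^*:\mathcal{A}^{**}\to\mathcal{A}$). *)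

theory Defs
  imports "HOL-Analysis.Analysis" "HOL-Library.Multiset"
begin

section \<open>Complex normed spaces and Banach algebras\<close>

text \<open>The distribution only has real normed spaces; a complex structure is added on top of the
  real one.\<close>

class complex_vector = real_vector +
  fixes scaleC :: "complex \<Rightarrow> 'a \<Rightarrow> 'a" (infixr "*\<^sub>C" 75)
  assumes scaleR_scaleC: "r *\<^sub>R x = complex_of_real r *\<^sub>C x"
    and scaleC_add_right: "c *\<^sub>C (x + y) = c *\<^sub>C x + c *\<^sub>C y"
    and scaleC_add_left: "(c + d) *\<^sub>C x = c *\<^sub>C x + d *\<^sub>C x"
    and scaleC_scaleC: "c *\<^sub>C d *\<^sub>C x = (c * d) *\<^sub>C x"
begin

lemma scaleC_one: "1 *\<^sub>C x = x"
  using scaleR_scaleC[of 1 x] scaleR_one by simp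

lemma scaleC_zero_left: "0 *\<^sub>C x = 0"
  using scaleC_add_left[of 0 0 x] by simp

lemma scaleC_zero_right: "c *\<^sub>C 0 = 0"
  using scaleC_add_right[of c 0 0] by simp

lemma scaleC_minus1: "(- 1) *\<^sub>C x = - x"
  using scaleC_add_left[of "- 1" 1 x]
  by (simp add: scaleC_one scaleC_zero_left eq_neg_iff_add_eq_0)

lemma scaleC_minus_right: "c *\<^sub>C (- x) = - (c *\<^sub>C x)"
  using scaleC_add_right[of c "- x" x] by (simp add: scaleC_zero_right eq_neg_iff_add_eq_0)

lemma scaleC_diff_right: "c *\<^sub>C (x - y) = c *\<^sub>C x - c *\<^sub>C y"
  using scaleC_add_right[of c x "- y"] by (simp add: scaleC_minus_right)

end

class complex_normed_vector = complex_vector + real_normed_vector +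
  assumes norm_scaleC: "norm (c *\<^sub>C x) = cmod c * norm x"

class complex_banach = complex_normed_vector + banach

text \<open>Not necessarily unital; \<^class>\<open>real_normed_algebra\<close> contains submultiplicativity of the norm.\<close>

class complex_banach_algebra = complex_banach + real_normed_algebra +
  assumes mult_scaleC_left: "(c *\<^sub>C x) * y = c *\<^sub>C (x * y)"
    and mult_scaleC_right: "x * (c *\<^sub>C y) = c *\<^sub>C (x * y)"

instantiation complex :: complex_banach_algebra
begin
definition scaleC_complex :: "complex \<Rightarrow> complex \<Rightarrow> complex" where "scaleC_complex c x = c * x"
instance
  by standard (auto simp: scaleC_complex_def scaleR_conv_of_real algebra_simps norm_mult)
end

definition bounded_clinear :: "('a::complex_normed_vector \<Rightarrow> 'b::complex_normed_vector) \<Rightarrow> bool"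
  where "bounded_clinear f \<longleftrightarrow> bounded_linear f \<and> (\<forall>c x. f (c *\<^sub>C x) = c *\<^sub>C f x)"

definition csubspace :: "'a::complex_vector set \<Rightarrow> bool"
  where "csubspace S \<longleftrightarrow> 0 \<in> S \<and> (\<forall>x\<in>S. \<forall>y\<in>S. x + y \<in> S) \<and> (\<forall>c. \<forall>x\<in>S. c *\<^sub>C x \<in> S)"


section \<open>Dual spaces\<close>

typedef (overloaded) 'a cdual = "{f :: 'a::complex_normed_vector \<Rightarrow> complex. bounded_clinear f}"
  morphisms cdual_apply Cdual
  by (rule exI[of _ "\<lambda>_. 0"]) (simp add: bounded_clinear_def scaleC_complex_def)

setup_lifting type_definition_cdual

lemma bounded_linear_cdual_apply: "bounded_linear (cdual_apply f)"
  using cdual_apply[of f] by (simp add: bounded_clinear_def)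

instantiation cdual :: (complex_normed_vector) complex_normed_vector
begin

lift_definition zero_cdual :: "'a cdual" is "\<lambda>_. 0"
  by (simp add: bounded_clinear_def scaleC_complex_def)
lift_definition plus_cdual :: "'a cdual \<Rightarrow> 'a cdual \<Rightarrow> 'a cdual" is "\<lambda>f g x. f x + g x"
  by (auto simp: bounded_clinear_def scaleC_complex_def algebra_simps bounded_linear_add)
lift_definition uminus_cdual :: "'a cdual \<Rightarrow> 'a cdual" is "\<lambda>f x. - f x"
  by (auto simp: bounded_clinear_def scaleC_complex_def algebra_simps bounded_linear_minus)
lift_definition minus_cdual :: "'a cdual \<Rightarrow> 'a cdual \<Rightarrow> 'a cdual" is "\<lambda>f g x. f x - g x"
  by (auto simp: bounded_clinear_def scaleC_complex_def algebra_simps bounded_linear_sub)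
lift_definition scaleC_cdual :: "complex \<Rightarrow> 'a cdual \<Rightarrow> 'a cdual" is "\<lambda>c f x. c * f x"
  by (auto simp: bounded_clinear_def scaleC_complex_def algebra_simps bounded_linear_const_mult)
lift_definition scaleR_cdual :: "real \<Rightarrow> 'a cdual \<Rightarrow> 'a cdual" is "\<lambda>r f x. r *\<^sub>R f x"
  by (auto simp: bounded_clinear_def scaleC_complex_def
      intro: bounded_linear_compose[OF bounded_linear_scaleR_right])
lift_definition norm_cdual :: "'a cdual \<Rightarrow> real" is onorm .

definition sgn_cdual :: "'a cdual \<Rightarrow> 'a cdual" where "sgn_cdual f = inverse (norm f) *\<^sub>R f"
definition dist_cdual :: "'a cdual \<Rightarrow> 'a cdual \<Rightarrow> real" where "dist_cdual f g = norm (f - g)"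
definition uniformity_cdual :: "('a cdual \<times> 'a cdual) filter"
  where "uniformity_cdual = (INF e\<in>{0<..}. principal {(x, y). dist x y < e})"
definition open_cdual :: "'a cdual set \<Rightarrow> bool"
  where "open_cdual U = (\<forall>x\<in>U. \<forall>\<^sub>F (x', y) in uniformity. x' = x \<longrightarrow> y \<in> U)"

instance
proof
  fix f g h :: "'a cdual" and c d :: complex and r s :: real
  show "f + g + h = f + (g + h)" "f + g = g + f" "0 + f = f" "- f + f = 0" "f - g = f + - g"
    by (transfer; simp add: fun_eq_iff algebra_simps)+
  show "r *\<^sub>R (f + g) = r *\<^sub>R f + r *\<^sub>R g" "(r + s) *\<^sub>R f = r *\<^sub>R f + s *\<^sub>R f"
    "r *\<^sub>R s *\<^sub>R f = (r * s) *\<^sub>R f" "1 *\<^sub>R f = f"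
    by (transfer; simp add: fun_eq_iff algebra_simps)+
  show "r *\<^sub>R f = complex_of_real r *\<^sub>C f" "c *\<^sub>C (f + g) = c *\<^sub>C f + c *\<^sub>C g"
    "(c + d) *\<^sub>C f = c *\<^sub>C f + d *\<^sub>C f" "c *\<^sub>C d *\<^sub>C f = (c * d) *\<^sub>C f"
    by (transfer; simp add: fun_eq_iff algebra_simps scaleR_conv_of_real)+
  show "norm (f + g) \<le> norm f + norm g"
    by transfer (rule onorm_triangle; simp add: bounded_clinear_def)
  show "norm (r *\<^sub>R f) = \<bar>r\<bar> * norm f"
    by transfer (rule onorm_scaleR; simp add: bounded_clinear_def)
  show "(norm f = 0) = (f = 0)"
    by transfer (simp add: onorm_eq_0 bounded_clinear_def fun_eq_iff)
  show "norm (c *\<^sub>C f) = cmod c * norm f"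
  proof transfer
    fix c and f :: "'a \<Rightarrow> complex" assume f: "bounded_clinear f"
    hence b: "bounded_linear f" by (simp add: bounded_clinear_def)
    show "onorm (\<lambda>x. c * f x) = cmod c * onorm f"
    proof (cases "c = 0")
      case True
      then show ?thesis by (simp add: onorm_zero)
    next
      case False
      show ?thesis
      proof (rule antisym)
        show "onorm (\<lambda>x. c * f x) \<le> cmod c * onorm f"
        proof (rule onorm_bound)
          show "0 \<le> cmod c * onorm f" using onorm_pos_le[OF b] by simp
          show "norm (c * f x) \<le> cmod c * onorm f * norm x" for x
            using onorm[OF b, of x] by (simp add: norm_mult mult_left_mono mult.assoc)
        qed
        have b': "bounded_linear (\<lambda>x. c * f x)" using b by (rule bounded_linear_const_mult)
        have "onorm f \<le> onorm (\<lambda>x. c * f x) / cmod c"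
        proof (rule onorm_bound)
          show "0 \<le> onorm (\<lambda>x. c * f x) / cmod c" using onorm_pos_le[OF b'] by simp
          show "norm (f x) \<le> onorm (\<lambda>x. c * f x) / cmod c * norm x" for x
            using onorm[OF b', of x] False by (simp add: norm_mult field_simps)
        qed
        thus "cmod c * onorm f \<le> onorm (\<lambda>x. c * f x)" using False by (simp add: field_simps)
      qed
    qed
  qed
qed (simp_all add: sgn_cdual_def dist_cdual_def uniformity_cdual_def open_cdual_def)

end

text \<open>The adjoint of a bounded linear map; meaningless if \<open>f\<close> is not bounded and linear.\<close>

definition cadjoint :: "('a::complex_normed_vector \<Rightarrow> 'b::complex_normed_vector) \<Rightarrow> 'b cdual \<Rightarrow> 'a cdual"
  where "cadjoint f \<phi> = Cdual (\<lambda>x. cdual_apply \<phi> (f x))"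

lemma cdual_apply_cadjoint:
  assumes "bounded_clinear f"
  shows "cdual_apply (cadjoint f \<phi>) x = cdual_apply \<phi> (f x)"
proof -
  have "bounded_clinear (\<lambda>x. cdual_apply \<phi> (f x))"
    using assms cdual_apply[of \<phi>]
    by (auto simp: bounded_clinear_def intro: bounded_linear_compose)
  thus ?thesis by (simp add: cadjoint_def Cdual_inverse)
qed

lemma bounded_clinear_cadjoint:
  assumes f: "bounded_clinear f"
  shows "bounded_clinear (cadjoint f)"
proof -
  have b: "bounded_linear f" using f by (simp add: bounded_clinear_def)
  have eq: "cadjoint f \<phi> = \<psi> \<longleftrightarrow> (\<forall>x. cdual_apply \<phi> (f x) = cdual_apply \<psi> x)" for \<phi> \<psi>
    by (simp add: cdual_apply_cadjoint[OF f] fun_eq_iff flip: cdual_apply_inject)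
  have scale: "cadjoint f (c *\<^sub>C \<phi>) = c *\<^sub>C cadjoint f \<phi>" for c \<phi>
    by (simp add: eq scaleC_cdual.rep_eq cdual_apply_cadjoint[OF f])
  have "bounded_linear (cadjoint f)"
  proof (rule bounded_linear_intro[where K = "onorm f"])
    show "cadjoint f (\<phi> + \<psi>) = cadjoint f \<phi> + cadjoint f \<psi>" for \<phi> \<psi>
      by (simp add: eq plus_cdual.rep_eq cdual_apply_cadjoint[OF f])
    show "cadjoint f (r *\<^sub>R \<phi>) = r *\<^sub>R cadjoint f \<phi>" for r \<phi>
      by (simp add: scale scaleR_scaleC)
    show "norm (cadjoint f \<phi>) \<le> norm \<phi> * onorm f" for \<phi>
      unfolding norm_cdual.rep_eq
    proof (rule onorm_bound)
      show "0 \<le> onorm (cdual_apply \<phi>) * onorm f"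
        by (intro mult_nonneg_nonneg onorm_pos_le b bounded_linear_cdual_apply)
      fix x
      have "norm (cdual_apply \<phi> (f x)) \<le> onorm (cdual_apply \<phi>) * norm (f x)"
        by (rule onorm[OF bounded_linear_cdual_apply])
      also have "\<dots> \<le> onorm (cdual_apply \<phi>) * (onorm f * norm x)"
        by (intro mult_left_mono onorm b onorm_pos_le bounded_linear_cdual_apply)
      finally show "norm (cdual_apply (cadjoint f \<phi>) x) \<le> onorm (cdual_apply \<phi>) * onorm f * norm x"
        by (simp add: cdual_apply_cadjoint[OF f] mult.assoc)
    qed
  qed
  thus ?thesis by (simp add: bounded_clinear_def scale)
qed

text \<open>The dual of a subspace \<open>S\<close>, which need not be a type: bounded linear functionals on \<open>S\<close>,
  normalised to vanish outside \<open>S\<close> so that equality is equality on \<open>S\<close>.\<close>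

definition zero_outside :: "'a set \<Rightarrow> ('a \<Rightarrow> complex) \<Rightarrow> 'a \<Rightarrow> complex"
  where "zero_outside S f = (\<lambda>x. if x \<in> S then f x else 0)"

definition dual_on :: "'a::complex_normed_vector set \<Rightarrow> ('a \<Rightarrow> complex) set"
  where "dual_on S = {f. (\<forall>x\<in>S. \<forall>y\<in>S. f (x + y) = f x + f y) \<and> (\<forall>c. \<forall>x\<in>S. f (c *\<^sub>C x) = c * f x)
    \<and> (\<exists>K. \<forall>x\<in>S. cmod (f x) \<le> K * norm x) \<and> (\<forall>x. x \<notin> S \<longrightarrow> f x = 0)}"

definition dual_norm_on :: "'a::complex_normed_vector set \<Rightarrow> ('a \<Rightarrow> complex) \<Rightarrow> real"
  where "dual_norm_on S f = (SUP x\<in>{x\<in>S. norm x \<le> 1}. cmod (f x))"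


section \<open>Algebraic and projective tensor products\<close>

text \<open>The multiset \<open>{#(a\<^sub>1,b\<^sub>1), \<dots>, (a\<^sub>n,b\<^sub>n)#}\<close> stands for the formal sum of the \<open>a\<^sub>i \<otimes> b\<^sub>i\<close>. Scalars
  need not be recorded, since they can be absorbed into the \<open>a\<^sub>i\<close>.\<close>

inductive tensor_rel :: "('a::complex_vector \<times> 'b::complex_vector) multiset \<Rightarrow> ('a \<times> 'b) multiset \<Rightarrow> bool"
  where
    tr_refl: "tensor_rel u u"
  | tr_sym: "tensor_rel u v \<Longrightarrow> tensor_rel v u"
  | tr_trans: "tensor_rel u v \<Longrightarrow> tensor_rel v w \<Longrightarrow> tensor_rel u w"
  | tr_add: "tensor_rel u v \<Longrightarrow> tensor_rel (u + w) (v + w)"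
  | tr_add_left: "tensor_rel {#(a + a', b)#} {#(a, b), (a', b)#}"
  | tr_add_right: "tensor_rel {#(a, b + b')#} {#(a, b), (a, b')#}"
  | tr_scale: "tensor_rel {#(c *\<^sub>C a, b)#} {#(a, c *\<^sub>C b)#}"
  | tr_zero: "tensor_rel {#(0, b)#} {#}"

quotient_type (overloaded) ('a, 'b) atensor =
  "('a::complex_vector \<times> 'b::complex_vector) multiset" / tensor_rel
  by (rule equivpI) (auto intro!: reflpI sympI transpI intro: tensor_rel.intros)

lemma tr_add2: "tensor_rel u u' \<Longrightarrow> tensor_rel v v' \<Longrightarrow> tensor_rel (u + v) (u' + v')"
  by (metis tr_add tr_trans add.commute)

definition scale_formal :: "complex \<Rightarrow> ('a::complex_vector \<times> 'b) multiset \<Rightarrow> ('a \<times> 'b) multiset"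
  where "scale_formal c = image_mset (\<lambda>(a, b). (c *\<^sub>C a, b))"

lemma scale_formal_simps [simp]:
  "scale_formal c {#} = {#}" "scale_formal c (add_mset (a, b) u) = add_mset (c *\<^sub>C a, b) (scale_formal c u)"
  "scale_formal c (u + v) = scale_formal c u + scale_formal c v"
  by (simp_all add: scale_formal_def)

lemma tr_scale_formal: "tensor_rel u v \<Longrightarrow> tensor_rel (scale_formal c u) (scale_formal c v)"
proof (induction rule: tensor_rel.induct)
  case (tr_scale d a b)
  have "tensor_rel {#(d *\<^sub>C (c *\<^sub>C a), b)#} {#(c *\<^sub>C a, d *\<^sub>C b)#}" by (rule tensor_rel.tr_scale)
  thus ?case by (simp add: scaleC_scaleC mult.commute)
qed (auto simp: scaleC_add_right scaleC_zero_right intro: tensor_rel.intros)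

lemma tr_scale_add: "tensor_rel (scale_formal (c + d) u) (scale_formal c u + scale_formal d u)"
proof (induction u)
  case empty
  then show ?case by (simp add: tr_refl)
next
  case (add x u)
  obtain a b where [simp]: "x = (a, b)" by force
  have "tensor_rel ({#((c + d) *\<^sub>C a, b)#} + scale_formal (c + d) u)
    ({#(c *\<^sub>C a, b), (d *\<^sub>C a, b)#} + (scale_formal c u + scale_formal d u))"
    by (rule tr_add2[OF _ add]) (simp add: scaleC_add_left tr_add_left)
  thus ?case by (simp add: add_mset_commute)
qed

lemma scale_formal_scale: "scale_formal c (scale_formal d u) = scale_formal (c * d) u"
  by (induction u) (auto simp: scaleC_scaleC)

lemma scale_formal_one: "scale_formal 1 u = u"
  by (induction u) (auto simp: scaleC_one)

lemma tr_scale_zero: "tensor_rel (scale_formal 0 u) {#}"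
proof (induction u)
  case empty
  then show ?case by (simp add: tr_refl)
next
  case (add x u)
  obtain a b where [simp]: "x = (a, b)" by force
  show ?case using tr_add2[OF tr_zero[of b] add] by (simp add: scaleC_zero_left)
qed

instantiation atensor :: (complex_vector, complex_vector) complex_vector
begin

lift_definition zero_atensor :: "('a, 'b) atensor" is "{#}" .
lift_definition plus_atensor :: "('a, 'b) atensor \<Rightarrow> ('a, 'b) atensor \<Rightarrow> ('a, 'b) atensor"
  is "(+)" by (rule tr_add2)
lift_definition uminus_atensor :: "('a, 'b) atensor \<Rightarrow> ('a, 'b) atensor"
  is "scale_formal (- 1)" by (rule tr_scale_formal)
lift_definition minus_atensor :: "('a, 'b) atensor \<Rightarrow> ('a, 'b) atensor \<Rightarrow> ('a, 'b) atensor"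
  is "\<lambda>u v. u + scale_formal (- 1) v" by (intro tr_add2 tr_scale_formal)
lift_definition scaleC_atensor :: "complex \<Rightarrow> ('a, 'b) atensor \<Rightarrow> ('a, 'b) atensor"
  is "scale_formal" by (rule tr_scale_formal)
lift_definition scaleR_atensor :: "real \<Rightarrow> ('a, 'b) atensor \<Rightarrow> ('a, 'b) atensor"
  is "\<lambda>r. scale_formal (complex_of_real r)" by (rule tr_scale_formal)

instance
proof
  fix f g h :: "('a, 'b) atensor" and c d :: complex and r s :: real
  show "f + g + h = f + (g + h)" "f + g = g + f" "0 + f = f" "f - g = f + - g"
    by (transfer; simp add: tr_refl algebra_simps)+
  show "- f + f = 0"
  proof transfer
    fix u :: "('a \<times> 'b) multiset"
    show "tensor_rel (scale_formal (- 1) u + u) {#}"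
      using tr_trans[OF tr_sym[OF tr_scale_add[of "- 1" 1 u]]] tr_scale_zero[of u]
      by (simp add: scale_formal_one)
  qed
  show "r *\<^sub>R (f + g) = r *\<^sub>R f + r *\<^sub>R g" "r *\<^sub>R s *\<^sub>R f = (r * s) *\<^sub>R f" "1 *\<^sub>R f = f"
    by (transfer; simp add: tr_refl scale_formal_scale scale_formal_one)+
  show "(r + s) *\<^sub>R f = r *\<^sub>R f + s *\<^sub>R f"
    by transfer (simp add: tr_scale_add)
  show "r *\<^sub>R f = complex_of_real r *\<^sub>C f" "c *\<^sub>C (f + g) = c *\<^sub>C f + c *\<^sub>C g"
    "c *\<^sub>C d *\<^sub>C f = (c * d) *\<^sub>C f"
    by (transfer; simp add: tr_refl scale_formal_scale)+
  show "(c + d) *\<^sub>C f = c *\<^sub>C f + d *\<^sub>C f"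
    by transfer (simp add: tr_scale_add)
qed

end

lift_definition atens :: "'a::complex_vector \<Rightarrow> 'b::complex_vector \<Rightarrow> ('a, 'b) atensor"
  is "\<lambda>a b. {#(a, b)#}" .

lemma atensor_induct [case_names zero add]:
  assumes "P 0" "\<And>a b t. P t \<Longrightarrow> P (atens a b + t)"
  shows "P t"
proof -
  have *: "P (abs_atensor u)" for u
  proof (induction u)
    case empty
    then show ?case using assms(1) by (simp add: zero_atensor_def)
  next
    case (add x u)
    obtain a b where [simp]: "x = (a, b)" by force
    have "abs_atensor (add_mset x u) = atens a b + abs_atensor u"
      by (simp add: atens.abs_eq plus_atensor.abs_eq)
    thus ?case using assms(2) add by metis
  qed
  show ?thesis using *[of "rep_atensor t"] by (simp add: Quotient3_abs_rep[OF Quotient3_atensor])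
qed

lemma atens_bilinear:
  "atens (a + a') b = atens a b + atens a' b" "atens a (b + b') = atens a b + atens a b'"
  "atens (c *\<^sub>C a) b = c *\<^sub>C atens a b" "atens a (c *\<^sub>C b) = c *\<^sub>C atens a b"
proof -
  show "atens (a + a') b = atens a b + atens a' b"
    by transfer (use tr_add_left in \<open>simp add: add_mset_commute\<close>)
  show "atens a (b + b') = atens a b + atens a b'"
    by transfer (use tr_add_right in \<open>simp add: add_mset_commute\<close>)
  show "atens (c *\<^sub>C a) b = c *\<^sub>C atens a b" by transfer (simp add: tr_refl)
  show "atens a (c *\<^sub>C b) = c *\<^sub>C atens a b" by transfer (simp add: tr_sym tr_scale)
qed

subsection \<open>The projective seminorm\<close>

definition formal_cost :: "('a::complex_normed_vector \<times> 'b::complex_normed_vector) multiset \<Rightarrow> real"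
  where "formal_cost u = (\<Sum>(a, b)\<in>#u. norm a * norm b)"

lemma formal_cost_simps [simp]:
  "formal_cost {#} = 0" "formal_cost (add_mset (a, b) u) = norm a * norm b + formal_cost u"
  "formal_cost (u + v) = formal_cost u + formal_cost v"
  by (simp_all add: formal_cost_def)

lemma formal_cost_nonneg: "formal_cost u \<ge> 0"
  by (induction u) auto

lemma formal_cost_scale: "formal_cost (scale_formal c u) = cmod c * formal_cost u"
  by (induction u) (auto simp: norm_scaleC algebra_simps)

definition proj_norm :: "('a::complex_normed_vector, 'b::complex_normed_vector) atensor \<Rightarrow> real"
  where "proj_norm t = (INF u\<in>{u. abs_atensor u = t}. formal_cost u)"

lemma bdd_formal_cost: "bdd_below (formal_cost ` X)"
  by (rule bdd_belowI[of _ 0]) (auto simp: formal_cost_nonneg)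

lemma atensor_rep_ex: "\<exists>u. abs_atensor u = t"
  using Quotient3_abs_rep[OF Quotient3_atensor] by blast

lemma proj_norm_le: "proj_norm (abs_atensor u) \<le> formal_cost u"
  unfolding proj_norm_def by (rule cINF_lower[OF bdd_formal_cost]) simp

lemma proj_norm_geI: "(\<And>u. abs_atensor u = t \<Longrightarrow> r \<le> formal_cost u) \<Longrightarrow> r \<le> proj_norm t"
  unfolding proj_norm_def using atensor_rep_ex[of t] by (intro cINF_greatest) auto

lemma proj_norm_nonneg: "0 \<le> proj_norm t"
  by (rule proj_norm_geI) (rule formal_cost_nonneg)

lemma proj_norm_triangle: "proj_norm (s + t) \<le> proj_norm s + proj_norm t"
proof -
  have "proj_norm (s + t) - formal_cost v \<le> proj_norm s" if v: "abs_atensor v = t" for v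
  proof (rule proj_norm_geI)
    fix u assume "abs_atensor u = s"
    hence "abs_atensor (u + v) = s + t" using v by (auto simp: plus_atensor.abs_eq)
    thus "proj_norm (s + t) - formal_cost v \<le> formal_cost u"
      using proj_norm_le[of "u + v"] by simp
  qed
  hence "proj_norm (s + t) - proj_norm s \<le> proj_norm t"
    by (intro proj_norm_geI) (simp add: algebra_simps)
  thus ?thesis by simp
qed

lemma proj_norm_scale_le: "proj_norm (c *\<^sub>C t) \<le> cmod c * proj_norm t"
proof (cases "c = 0")
  case True
  have "proj_norm (0 :: ('a, 'b) atensor) \<le> 0"
    using proj_norm_le[of "{#}"] by (simp add: zero_atensor.abs_eq)
  thus ?thesis using True by (simp add: scaleC_zero_left)
next
  case False
  have "proj_norm (c *\<^sub>C t) / cmod c \<le> proj_norm t"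
  proof (rule proj_norm_geI)
    fix u assume "abs_atensor u = t"
    hence "abs_atensor (scale_formal c u) = c *\<^sub>C t" by (auto simp: scaleC_atensor.abs_eq)
    thus "proj_norm (c *\<^sub>C t) / cmod c \<le> formal_cost u"
      using proj_norm_le[of "scale_formal c u"] False
      by (simp add: formal_cost_scale field_simps)
  qed
  thus ?thesis using False by (simp add: field_simps)
qed

lemma proj_norm_scale: "proj_norm (c *\<^sub>C t) = cmod c * proj_norm t"
proof (cases "c = 0")
  case True
  then show ?thesis using proj_norm_scale_le[of 0 t] proj_norm_nonneg[of "0 *\<^sub>C t"] by simp
next
  case False
  have "proj_norm (inverse c *\<^sub>C c *\<^sub>C t) \<le> inverse (cmod c) * proj_norm (c *\<^sub>C t)"
    using proj_norm_scale_le[of "inverse c" "c *\<^sub>C t"] by (simp add: norm_inverse)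
  hence "cmod c * proj_norm t \<le> proj_norm (c *\<^sub>C t)"
    using False by (simp add: scaleC_scaleC scaleC_one field_simps)
  thus ?thesis using proj_norm_scale_le[of c t] by simp
qed

lemma proj_norm_0 [simp]: "proj_norm 0 = 0"
  using proj_norm_scale[of 0 0] by (simp add: scaleC_zero_left)

lemma proj_norm_minus [simp]: "proj_norm (- t) = proj_norm t"
  using proj_norm_scale[of "- 1" t] by (simp add: scaleC_minus1)

lemma proj_norm_commute: "proj_norm (s - t) = proj_norm (t - s)"
  using proj_norm_minus[of "s - t"] by simp

lemma proj_norm_tri2: "proj_norm (s - t) \<le> proj_norm (s - r) + proj_norm (r - t)"
  using proj_norm_triangle[of "s - r" "r - t"] by simp

lemma proj_norm_diff: "\<bar>proj_norm s - proj_norm t\<bar> \<le> proj_norm (s - t)"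
  using proj_norm_triangle[of "s - t" t] proj_norm_triangle[of "t - s" s] proj_norm_commute[of s t]
  by simp

subsection \<open>Completion\<close>

definition proj_Cauchy :: "(nat \<Rightarrow> ('a::complex_normed_vector, 'b::complex_normed_vector) atensor) \<Rightarrow> bool"
  where "proj_Cauchy u \<longleftrightarrow> (\<forall>e>0. \<exists>N. \<forall>m\<ge>N. \<forall>n\<ge>N. proj_norm (u m - u n) < e)"

definition proj_equiv :: "(nat \<Rightarrow> ('a::complex_normed_vector, 'b::complex_normed_vector) atensor) \<Rightarrow>
    (nat \<Rightarrow> ('a, 'b) atensor) \<Rightarrow> bool"
  where "proj_equiv u v \<longleftrightarrow> proj_Cauchy u \<and> proj_Cauchy v \<and> (\<lambda>n. proj_norm (u n - v n)) \<longlonglongrightarrow> 0"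

lemma proj_null_trans:
  assumes "(\<lambda>n. proj_norm (u n - v n)) \<longlonglongrightarrow> 0" "(\<lambda>n. proj_norm (v n - w n)) \<longlonglongrightarrow> 0"
  shows "(\<lambda>n. proj_norm (u n - w n)) \<longlonglongrightarrow> 0"
proof (rule tendsto_sandwich[OF _ _ tendsto_const])
  show "(\<lambda>n. proj_norm (u n - v n) + proj_norm (v n - w n)) \<longlonglongrightarrow> 0"
    using tendsto_add[OF assms] by simp
qed (simp_all add: proj_norm_nonneg proj_norm_tri2)

lemma proj_Cauchy_const: "proj_Cauchy (\<lambda>_. t)"
  by (simp add: proj_Cauchy_def)

text \<open>The completion of the algebraic tensor product: Cauchy sequences modulo null sequences.
  Dividing by null sequences makes the projective seminorm a norm, so that it does not have to be
  shown beforehand that \<^const>\<open>proj_norm\<close> is definite.\<close>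

quotient_type (overloaded) ('a, 'b) ptensor =
  "nat \<Rightarrow> ('a::complex_normed_vector, 'b::complex_normed_vector) atensor" / partial: proj_equiv
proof (rule part_equivpI)
  show "\<exists>u. proj_equiv u u"
    by (rule exI[of _ "\<lambda>_. 0"]) (simp add: proj_equiv_def proj_Cauchy_const)
  show "symp (proj_equiv :: _ \<Rightarrow> (nat \<Rightarrow> ('a, 'b) atensor) \<Rightarrow> bool)"
    by (rule sympI) (auto simp: proj_equiv_def proj_norm_commute)
  show "transp (proj_equiv :: _ \<Rightarrow> (nat \<Rightarrow> ('a, 'b) atensor) \<Rightarrow> bool)"
    by (rule transpI) (auto simp: proj_equiv_def intro: proj_null_trans)
qed

lemma proj_equiv_refl [simp]: "proj_equiv u u \<longleftrightarrow> proj_Cauchy u"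
  by (simp add: proj_equiv_def)

lemma ptensor_cases:
  obtains u where "proj_Cauchy u" "x = abs_ptensor u"
  using Quotient3_abs_rep[OF Quotient3_ptensor] Quotient3_rep_reflp[OF Quotient3_ptensor]
  by (metis proj_equiv_refl)

lemma abs_ptensor_eq:
  assumes "proj_Cauchy u" "proj_Cauchy v"
  shows "abs_ptensor u = abs_ptensor v \<longleftrightarrow> (\<lambda>n. proj_norm (u n - v n)) \<longlonglongrightarrow> 0"
  using Quotient3_rel[OF Quotient3_ptensor, of u v] assms by (simp add: proj_equiv_def)

lemma proj_Cauchy_add:
  assumes "proj_Cauchy u" "proj_Cauchy v" shows "proj_Cauchy (\<lambda>n. u n + v n)"
  unfolding proj_Cauchy_def
proof (intro allI impI)
  fix e :: real assume "e > 0"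
  then obtain N M where N: "\<And>m n. m \<ge> N \<Longrightarrow> n \<ge> N \<Longrightarrow> proj_norm (u m - u n) < e / 2"
    and M: "\<And>m n. m \<ge> M \<Longrightarrow> n \<ge> M \<Longrightarrow> proj_norm (v m - v n) < e / 2"
    using assms unfolding proj_Cauchy_def by (meson half_gt_zero)
  have "proj_norm ((u m + v m) - (u n + v n)) < e" if "m \<ge> max N M" "n \<ge> max N M" for m n
    using proj_norm_triangle[of "u m - u n" "v m - v n"] N[of m n] M[of m n] that
    by (simp add: algebra_simps)
  thus "\<exists>N. \<forall>m\<ge>N. \<forall>n\<ge>N. proj_norm (u m + v m - (u n + v n)) < e" by blast
qed

lemma proj_Cauchy_scale:
  assumes "proj_Cauchy u" shows "proj_Cauchy (\<lambda>n. c *\<^sub>C u n)"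
  unfolding proj_Cauchy_def
proof (intro allI impI)
  fix e :: real assume "e > 0"
  hence "e / (cmod c + 1) > 0" by (simp add: add_nonneg_pos)
  then obtain N where N: "\<And>m n. m \<ge> N \<Longrightarrow> n \<ge> N \<Longrightarrow> proj_norm (u m - u n) < e / (cmod c + 1)"
    using assms unfolding proj_Cauchy_def by blast
  have "proj_norm (c *\<^sub>C u m - c *\<^sub>C u n) < e" if "m \<ge> N" "n \<ge> N" for m n
  proof -
    have "proj_norm (c *\<^sub>C u m - c *\<^sub>C u n) = cmod c * proj_norm (u m - u n)"
      by (simp add: proj_norm_scale flip: scaleC_diff_right)
    also have "\<dots> \<le> (cmod c + 1) * proj_norm (u m - u n)"
      by (intro mult_right_mono) (auto simp: proj_norm_nonneg)
    also have "\<dots> < e"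
      using N[OF that] by (simp add: pos_less_divide_eq add_nonneg_pos mult.commute)
    finally show ?thesis .
  qed
  thus "\<exists>N. \<forall>m\<ge>N. \<forall>n\<ge>N. proj_norm (c *\<^sub>C u m - c *\<^sub>C u n) < e" by blast
qed

lemma proj_Cauchy_minus: "proj_Cauchy u \<Longrightarrow> proj_Cauchy (\<lambda>n. - u n)"
  using proj_Cauchy_scale[of u "- 1"] by (simp add: scaleC_minus1)

lemma proj_Cauchy_diff: "proj_Cauchy u \<Longrightarrow> proj_Cauchy v \<Longrightarrow> proj_Cauchy (\<lambda>n. u n - v n)"
  using proj_Cauchy_add[OF _ proj_Cauchy_minus] by fastforce

lemma proj_equiv_add:
  assumes "proj_equiv u u'" "proj_equiv v v'"
  shows "proj_equiv (\<lambda>n. u n + v n) (\<lambda>n. u' n + v' n)"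
proof -
  have "(\<lambda>n. proj_norm ((u n + v n) - (u' n + v' n))) \<longlonglongrightarrow> 0"
  proof (rule tendsto_sandwich[OF _ _ tendsto_const])
    show "(\<lambda>n. proj_norm (u n - u' n) + proj_norm (v n - v' n)) \<longlonglongrightarrow> 0"
      using tendsto_add[of _ 0 _ _ 0] assms by (fastforce simp: proj_equiv_def)
    have "proj_norm ((u n + v n) - (u' n + v' n)) \<le> proj_norm (u n - u' n) + proj_norm (v n - v' n)" for n
      using proj_norm_triangle[of "u n - u' n" "v n - v' n"] by (simp add: algebra_simps)
    thus "\<forall>\<^sub>F n in sequentially. proj_norm ((u n + v n) - (u' n + v' n)) \<le>
        proj_norm (u n - u' n) + proj_norm (v n - v' n)" by simp
  qed (simp add: proj_norm_nonneg)
  thus ?thesis using assms by (simp add: proj_equiv_def proj_Cauchy_add)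
qed

lemma proj_equiv_scale:
  assumes "proj_equiv u u'" shows "proj_equiv (\<lambda>n. c *\<^sub>C u n) (\<lambda>n. c *\<^sub>C u' n)"
proof -
  have "(\<lambda>n. cmod c * proj_norm (u n - u' n)) \<longlonglongrightarrow> 0"
    using assms tendsto_mult_right_zero by (auto simp: proj_equiv_def)
  thus ?thesis
    using assms by (simp add: proj_equiv_def proj_Cauchy_scale proj_norm_scale flip: scaleC_diff_right)
qed

lemma proj_equiv_minus: "proj_equiv u u' \<Longrightarrow> proj_equiv (\<lambda>n. - u n) (\<lambda>n. - u' n)"
  using proj_equiv_scale[of u u' "- 1"] by (simp add: scaleC_minus1)

lemma proj_equiv_diff:
  "proj_equiv u u' \<Longrightarrow> proj_equiv v v' \<Longrightarrow> proj_equiv (\<lambda>n. u n - v n) (\<lambda>n. u' n - v' n)"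
  using proj_equiv_add[OF _ proj_equiv_minus] by fastforce

lemma proj_norm_convergent:
  assumes "proj_Cauchy u" shows "convergent (\<lambda>n. proj_norm (u n))"
proof -
  have "Cauchy (\<lambda>n. proj_norm (u n))"
  proof (rule metric_CauchyI)
    fix e :: real assume "e > 0"
    then obtain N where "\<And>m n. m \<ge> N \<Longrightarrow> n \<ge> N \<Longrightarrow> proj_norm (u m - u n) < e"
      using assms unfolding proj_Cauchy_def by blast
    thus "\<exists>M. \<forall>m\<ge>M. \<forall>n\<ge>M. dist (proj_norm (u m)) (proj_norm (u n)) < e"
      using proj_norm_diff by (metis dist_real_def order_le_less_trans)
  qed
  thus ?thesis by (rule real_Cauchy_convergent)
qed

lemma proj_norm_equiv_lim:
  assumes "proj_equiv u v" shows "lim (\<lambda>n. proj_norm (u n)) = lim (\<lambda>n. proj_norm (v n))"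
proof -
  have "(\<lambda>n. proj_norm (u n) - proj_norm (v n)) \<longlonglongrightarrow> 0"
  proof (rule Lim_null_comparison)
    show "(\<lambda>n. proj_norm (u n - v n)) \<longlonglongrightarrow> 0" using assms by (simp add: proj_equiv_def)
  qed (simp add: proj_norm_diff)
  moreover have "(\<lambda>n. proj_norm (u n) - proj_norm (v n)) \<longlonglongrightarrow>
      lim (\<lambda>n. proj_norm (u n)) - lim (\<lambda>n. proj_norm (v n))"
    using assms proj_norm_convergent
    by (intro tendsto_diff) (auto simp: proj_equiv_def convergent_LIMSEQ_iff)
  ultimately have "lim (\<lambda>n. proj_norm (u n)) - lim (\<lambda>n. proj_norm (v n)) = 0"
    by (rule LIMSEQ_unique[symmetric])
  thus ?thesis by simp
qed

instantiation ptensor :: (complex_normed_vector, complex_normed_vector) complex_normed_vector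
begin

lift_definition zero_ptensor :: "('a, 'b) ptensor" is "\<lambda>_. 0"
  by (simp add: proj_Cauchy_const)
lift_definition plus_ptensor :: "('a, 'b) ptensor \<Rightarrow> ('a, 'b) ptensor \<Rightarrow> ('a, 'b) ptensor"
  is "\<lambda>u v n. u n + v n" by (rule proj_equiv_add)
lift_definition uminus_ptensor :: "('a, 'b) ptensor \<Rightarrow> ('a, 'b) ptensor"
  is "\<lambda>u n. - u n" by (rule proj_equiv_minus)
lift_definition minus_ptensor :: "('a, 'b) ptensor \<Rightarrow> ('a, 'b) ptensor \<Rightarrow> ('a, 'b) ptensor"
  is "\<lambda>u v n. u n - v n" by (rule proj_equiv_diff)
lift_definition scaleC_ptensor :: "complex \<Rightarrow> ('a, 'b) ptensor \<Rightarrow> ('a, 'b) ptensor"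
  is "\<lambda>c u n. c *\<^sub>C u n" by (rule proj_equiv_scale)
lift_definition scaleR_ptensor :: "real \<Rightarrow> ('a, 'b) ptensor \<Rightarrow> ('a, 'b) ptensor"
  is "\<lambda>r u n. complex_of_real r *\<^sub>C u n" by (rule proj_equiv_scale)
lift_definition norm_ptensor :: "('a, 'b) ptensor \<Rightarrow> real"
  is "\<lambda>u. lim (\<lambda>n. proj_norm (u n))" by (rule proj_norm_equiv_lim)

definition sgn_ptensor :: "('a, 'b) ptensor \<Rightarrow> ('a, 'b) ptensor"
  where "sgn_ptensor f = inverse (norm f) *\<^sub>R f"
definition dist_ptensor :: "('a, 'b) ptensor \<Rightarrow> ('a, 'b) ptensor \<Rightarrow> real"
  where "dist_ptensor f g = norm (f - g)"
definition uniformity_ptensor :: "(('a, 'b) ptensor \<times> ('a, 'b) ptensor) filter"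
  where "uniformity_ptensor = (INF e\<in>{0<..}. principal {(x, y). dist x y < e})"
definition open_ptensor :: "('a, 'b) ptensor set \<Rightarrow> bool"
  where "open_ptensor U = (\<forall>x\<in>U. \<forall>\<^sub>F (x', y) in uniformity. x' = x \<longrightarrow> y \<in> U)"

lemma abs_ptensor_simps:
  assumes "proj_Cauchy u"
  shows "proj_Cauchy v \<Longrightarrow> abs_ptensor u + abs_ptensor v = abs_ptensor (\<lambda>n. u n + v n)"
    "proj_Cauchy v \<Longrightarrow> abs_ptensor u - abs_ptensor v = abs_ptensor (\<lambda>n. u n - v n)"
    "- abs_ptensor u = abs_ptensor (\<lambda>n. - u n)"
    "c *\<^sub>C abs_ptensor u = abs_ptensor (\<lambda>n. c *\<^sub>C u n)"
    "r *\<^sub>R abs_ptensor u = abs_ptensor (\<lambda>n. complex_of_real r *\<^sub>C u n)"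
    "norm (abs_ptensor u) = lim (\<lambda>n. proj_norm (u n))"
  using assms by (simp_all add: plus_ptensor.abs_eq minus_ptensor.abs_eq uminus_ptensor.abs_eq
      scaleC_ptensor.abs_eq scaleR_ptensor.abs_eq norm_ptensor.abs_eq)

lemma norm_abs_ptensor:
  assumes "proj_Cauchy u" shows "(\<lambda>n. proj_norm (u n)) \<longlonglongrightarrow> norm (abs_ptensor u)"
  using assms proj_norm_convergent by (simp add: abs_ptensor_simps convergent_LIMSEQ_iff)

instance
proof
  fix f g h :: "('a, 'b) ptensor" and c d :: complex and r s :: real
  obtain u where u [simp]: "proj_Cauchy u" and [simp]: "f = abs_ptensor u" by (rule ptensor_cases)
  obtain v where v [simp]: "proj_Cauchy v" and [simp]: "g = abs_ptensor v" by (rule ptensor_cases)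
  obtain w where w [simp]: "proj_Cauchy w" and [simp]: "h = abs_ptensor w" by (rule ptensor_cases)
  note [simp] = abs_ptensor_simps proj_Cauchy_add proj_Cauchy_diff proj_Cauchy_minus
    proj_Cauchy_scale proj_Cauchy_const zero_ptensor.abs_eq
  show "f + g + h = f + (g + h)" "f + g = g + f" "0 + f = f" "- f + f = 0" "f - g = f + - g"
    by (simp_all add: algebra_simps)
  show "r *\<^sub>R (f + g) = r *\<^sub>R f + r *\<^sub>R g" "(r + s) *\<^sub>R f = r *\<^sub>R f + s *\<^sub>R f"
    "r *\<^sub>R s *\<^sub>R f = (r * s) *\<^sub>R f" "1 *\<^sub>R f = f"
    by (simp_all add: scaleC_add_right scaleC_add_left scaleC_scaleC scaleC_one)
  show "r *\<^sub>R f = complex_of_real r *\<^sub>C f" "c *\<^sub>C (f + g) = c *\<^sub>C f + c *\<^sub>C g"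
    "(c + d) *\<^sub>C f = c *\<^sub>C f + d *\<^sub>C f" "c *\<^sub>C d *\<^sub>C f = (c * d) *\<^sub>C f"
    by (simp_all add: scaleC_add_right scaleC_add_left scaleC_scaleC)
  have nscale: "norm (c *\<^sub>C f) = cmod c * norm f" for c
  proof -
    have "(\<lambda>n. proj_norm (c *\<^sub>C u n)) \<longlonglongrightarrow> cmod c * norm (abs_ptensor u)"
      unfolding proj_norm_scale by (intro tendsto_mult_left norm_abs_ptensor u)
    thus ?thesis by (simp add: limI)
  qed
  show "norm (c *\<^sub>C f) = cmod c * norm f" by (rule nscale)
  show "norm (r *\<^sub>R f) = \<bar>r\<bar> * norm f"
    using nscale[of "complex_of_real r"] by simp
  show "norm (f + g) \<le> norm f + norm g"
  proof -
    have "norm (abs_ptensor (\<lambda>n. u n + v n)) \<le> norm (abs_ptensor u) + norm (abs_ptensor v)"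
    proof (rule LIMSEQ_le)
      show "(\<lambda>n. proj_norm (u n + v n)) \<longlonglongrightarrow> norm (abs_ptensor (\<lambda>n. u n + v n))"
        by (intro norm_abs_ptensor proj_Cauchy_add u v)
      show "(\<lambda>n. proj_norm (u n) + proj_norm (v n)) \<longlonglongrightarrow> norm (abs_ptensor u) + norm (abs_ptensor v)"
        by (intro tendsto_add norm_abs_ptensor u v)
    qed (auto simp: proj_norm_triangle)
    thus ?thesis by simp
  qed
  show "(norm f = 0) = (f = 0)"
  proof
    assume "norm f = 0"
    hence "(\<lambda>n. proj_norm (u n)) \<longlonglongrightarrow> 0" using norm_abs_ptensor[OF u] by simp
    thus "f = 0" by (simp add: abs_ptensor_eq)
  qed simp
qed (simp_all add: sgn_ptensor_def dist_ptensor_def uniformity_ptensor_def open_ptensor_def)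

end

lemma norm_ptensor_const:
  "norm (abs_ptensor (\<lambda>_. s) :: ('a::complex_normed_vector, 'b::complex_normed_vector) ptensor) = proj_norm s"
  by (simp add: abs_ptensor_simps proj_Cauchy_const)

lemma ptensor_approx:
  assumes u: "proj_Cauchy u" and e: "e > 0"
  shows "\<exists>N. \<forall>n\<ge>N. norm (abs_ptensor u - abs_ptensor (\<lambda>_. u n)) \<le> e"
proof -
  obtain N where N: "\<And>m n. m \<ge> N \<Longrightarrow> n \<ge> N \<Longrightarrow> proj_norm (u m - u n) < e"
    using u e unfolding proj_Cauchy_def by blast
  have "norm (abs_ptensor u - abs_ptensor (\<lambda>_. u n)) \<le> e" if "n \<ge> N" for n
  proof (rule LIMSEQ_le_const2)
    show "(\<lambda>m. proj_norm (u m - u n)) \<longlonglongrightarrow> norm (abs_ptensor u - abs_ptensor (\<lambda>_. u n))"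
      using norm_abs_ptensor[OF proj_Cauchy_diff[OF u proj_Cauchy_const]]
      by (simp add: abs_ptensor_simps u proj_Cauchy_const)
    show "\<exists>N. \<forall>m\<ge>N. proj_norm (u m - u n) \<le> e"
      using N that by (meson less_imp_le)
  qed
  thus ?thesis by blast
qed

lemma ptensor_complete:
  fixes X :: "nat \<Rightarrow> ('a::complex_normed_vector, 'b::complex_normed_vector) ptensor"
  assumes X: "Cauchy X"
  shows "convergent X"
proof -
  let ?c = "\<lambda>t. abs_ptensor (\<lambda>_::nat. t) :: ('a, 'b) ptensor"
  have normc: "norm (?c s - ?c t) = proj_norm (s - t)" for s t
    by (simp add: abs_ptensor_simps proj_Cauchy_const)
  have tri3: "norm (x - z) \<le> norm (x - y) + norm (y - z)" for x y z :: "('a, 'b) ptensor"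
    using norm_triangle_ineq[of "x - y" "y - z"] by simp
  have "\<exists>t. norm (X n - ?c t) \<le> inverse (real (Suc n))" for n
  proof -
    obtain u where u: "proj_Cauchy u" "X n = abs_ptensor u" by (rule ptensor_cases)
    show ?thesis using ptensor_approx[OF u(1), of "inverse (real (Suc n))"] u(2) by auto
  qed
  hence "\<exists>v. \<forall>n. norm (X n - ?c (v n)) \<le> inverse (real (Suc n))" by (intro choice allI)
  then obtain v where v': "\<forall>n. norm (X n - ?c (v n)) \<le> inverse (real (Suc n))" by (elim exE)
  note v = v'[THEN spec]
  have small: "\<exists>N. \<forall>n\<ge>N. norm (X n - ?c (v n)) < e" if e: "e > 0" for e :: real
  proof -
    obtain N where N: "inverse (real (Suc N)) < e" using reals_Archimedean[OF e] by (elim exE)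
    have "norm (X n - ?c (v n)) < e" if "n \<ge> N" for n
    proof -
      have "inverse (real (Suc n)) \<le> inverse (real (Suc N))" using that by simp
      from order_trans[OF v this] N show ?thesis by (rule order_le_less_trans)
    qed
    thus ?thesis by (intro exI allI impI)
  qed
  have vC: "proj_Cauchy v"
    unfolding proj_Cauchy_def
  proof (intro allI impI)
    fix e :: real assume e: "e > 0"
    then obtain N where N: "\<And>m n. m \<ge> N \<Longrightarrow> n \<ge> N \<Longrightarrow> norm (X m - X n) < e / 3"
      using CauchyD[OF X, of "e / 3"] by auto
    obtain M where M: "\<And>n. n \<ge> M \<Longrightarrow> norm (X n - ?c (v n)) < e / 3"
      using small[of "e / 3"] e by auto
    have "proj_norm (v m - v n) < e" if "m \<ge> max N M" "n \<ge> max N M" for m n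
    proof -
      have "norm (?c (v m) - ?c (v n)) \<le> norm (?c (v m) - X m) + (norm (X m - X n) + norm (X n - ?c (v n)))"
        using tri3[of "?c (v m)" "?c (v n)" "X m"] tri3[of "X m" "?c (v n)" "X n"] by linarith
      moreover have "norm (?c (v m) - X m) < e / 3" using M[of m] that by (simp add: norm_minus_commute)
      ultimately show ?thesis using N[of m n] M[of n] that unfolding normc by simp
    qed
    thus "\<exists>N. \<forall>m\<ge>N. \<forall>n\<ge>N. proj_norm (v m - v n) < e" by blast
  qed
  have "\<exists>N. \<forall>n\<ge>N. norm (X n - abs_ptensor v) < e" if e: "e > 0" for e
  proof -
    obtain N where N: "\<And>n. n \<ge> N \<Longrightarrow> norm (abs_ptensor v - ?c (v n)) \<le> e / 2"
      using ptensor_approx[OF vC, of "e / 2"] e by auto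
    obtain M where M: "\<And>n. n \<ge> M \<Longrightarrow> norm (X n - ?c (v n)) < e / 2"
      using small[of "e / 2"] e by auto
    have "norm (X n - abs_ptensor v) < e" if "n \<ge> max N M" for n
      using tri3[of "X n" "abs_ptensor v" "?c (v n)"] N[of n] M[of n] that
      by (simp add: norm_minus_commute)
    thus ?thesis by blast
  qed
  hence "X \<longlonglongrightarrow> abs_ptensor v" by (simp add: LIMSEQ_iff)
  thus ?thesis by (rule convergentI)
qed

instance ptensor :: (complex_normed_vector, complex_normed_vector) complex_banach
  by standard (rule ptensor_complete)

definition tens :: "'a::complex_normed_vector \<Rightarrow> 'b::complex_normed_vector \<Rightarrow> ('a, 'b) ptensor"
  where "tens a b = abs_ptensor (\<lambda>_. atens a b)"

subsection \<open>Linearisation of bounded bilinear maps\<close>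

definition bounded_cbilinear ::
    "('a::complex_normed_vector \<Rightarrow> 'b::complex_normed_vector \<Rightarrow> 'c::complex_normed_vector) \<Rightarrow> bool"
  where "bounded_cbilinear \<phi> \<longleftrightarrow> bounded_bilinear \<phi> \<and>
    (\<forall>c a b. \<phi> (c *\<^sub>C a) b = c *\<^sub>C \<phi> a b \<and> \<phi> a (c *\<^sub>C b) = c *\<^sub>C \<phi> a b)"

text \<open>The bounded linear map with \<open>a \<otimes> b \<mapsto> \<phi> a b\<close>; it exists and is unique whenever \<open>\<phi>\<close> is
  bounded, bilinear and has values in a Banach space (\<open>ptensor_universal\<close> below).\<close>

definition ptensor_lift ::
    "('a::complex_normed_vector \<Rightarrow> 'b::complex_normed_vector \<Rightarrow> 'c::complex_normed_vector) \<Rightarrow>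
      ('a, 'b) ptensor \<Rightarrow> 'c"
  where "ptensor_lift \<phi> = (THE T. bounded_clinear T \<and> (\<forall>a b. T (tens a b) = \<phi> a b))"

definition formal_eval :: "('a \<Rightarrow> 'b \<Rightarrow> 'c::comm_monoid_add) \<Rightarrow> ('a \<times> 'b) multiset \<Rightarrow> 'c"
  where "formal_eval \<phi> u = (\<Sum>(a, b)\<in>#u. \<phi> a b)"

lemma formal_eval_simps [simp]:
  "formal_eval \<phi> {#} = 0" "formal_eval \<phi> (add_mset (a, b) u) = \<phi> a b + formal_eval \<phi> u"
  "formal_eval \<phi> (u + v) = formal_eval \<phi> u + formal_eval \<phi> v"
  by (simp_all add: formal_eval_def)

context
  fixes \<phi> :: "'a::complex_normed_vector \<Rightarrow> 'b::complex_normed_vector \<Rightarrow> 'c::complex_banach"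
  assumes \<phi>: "bounded_cbilinear \<phi>"
begin

lemma formal_eval_rel: "tensor_rel u v \<Longrightarrow> formal_eval \<phi> u = formal_eval \<phi> v"
proof (induction rule: tensor_rel.induct)
qed (use \<phi> in \<open>auto simp: bounded_cbilinear_def bounded_bilinear.add_left
    bounded_bilinear.add_right bounded_bilinear.zero_left\<close>)

definition atensor_eval :: "('a, 'b) atensor \<Rightarrow> 'c"
  where "atensor_eval t = formal_eval \<phi> (rep_atensor t)"

lemma atensor_eval_abs: "atensor_eval (abs_atensor u) = formal_eval \<phi> u"
  unfolding atensor_eval_def
  by (rule formal_eval_rel) (rule Quotient3_rep_abs[OF Quotient3_atensor], rule tr_refl)

lemma atensor_eval_atens: "atensor_eval (atens a b) = \<phi> a b"
  by (simp add: atens.abs_eq atensor_eval_abs)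

lemma atensor_eval_add: "atensor_eval (s + t) = atensor_eval s + atensor_eval t"
proof -
  obtain u v where "abs_atensor u = s" "abs_atensor v = t" using atensor_rep_ex by metis
  thus ?thesis by (auto simp: plus_atensor.abs_eq atensor_eval_abs)
qed

lemma atensor_eval_scale: "atensor_eval (c *\<^sub>C t) = c *\<^sub>C atensor_eval t"
proof -
  obtain u where u: "abs_atensor u = t" using atensor_rep_ex by metis
  have "formal_eval \<phi> (scale_formal c u) = c *\<^sub>C formal_eval \<phi> u"
  proof (induction u)
    case (add x u)
    then show ?case using \<phi> by (cases x) (simp add: bounded_cbilinear_def scaleC_add_right)
  qed (simp add: scaleC_zero_right)
  thus ?thesis using u by (auto simp: scaleC_atensor.abs_eq atensor_eval_abs)
qed

lemma atensor_eval_diff: "atensor_eval (s - t) = atensor_eval s - atensor_eval t"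
  using atensor_eval_add[of "s - t" t] by (simp add: algebra_simps)

lemma atensor_eval_bound:
  obtains K where "K > 0" "\<And>t. norm (atensor_eval t) \<le> K * proj_norm t"
proof -
  have "bounded_bilinear \<phi>" using \<phi> by (simp add: bounded_cbilinear_def)
  then obtain K where K: "K > 0" "\<And>a b. norm (\<phi> a b) \<le> norm a * norm b * K"
    using bounded_bilinear.pos_bounded by blast
  have "norm (formal_eval \<phi> u) \<le> K * formal_cost u" for u
  proof (induction u)
    case (add x u)
    obtain a b where [simp]: "x = (a, b)" by force
    have "norm (formal_eval \<phi> (add_mset x u)) \<le> norm (\<phi> a b) + norm (formal_eval \<phi> u)"
      by (simp add: norm_triangle_ineq)
    thus ?case using add K(2)[of a b] by (simp add: algebra_simps)
  qed simp
  hence "norm (atensor_eval t) / K \<le> proj_norm t" for t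
    using K(1) by (intro proj_norm_geI) (auto simp: atensor_eval_abs field_simps)
  hence "norm (atensor_eval t) \<le> K * proj_norm t" for t
    using K(1) by (simp add: pos_divide_le_eq mult.commute)
  thus ?thesis using that K(1) by blast
qed

lemma atensor_eval_convergent:
  assumes u: "proj_Cauchy u" shows "convergent (\<lambda>n. atensor_eval (u n))"
proof -
  obtain K where K: "K > 0" "\<And>t. norm (atensor_eval t) \<le> K * proj_norm t"
    using atensor_eval_bound by blast
  have "Cauchy (\<lambda>n. atensor_eval (u n))"
  proof (rule CauchyI)
    fix e :: real assume "e > 0"
    hence "e / K > 0" using K(1) by simp
    then obtain N where N: "\<And>m n. m \<ge> N \<Longrightarrow> n \<ge> N \<Longrightarrow> proj_norm (u m - u n) < e / K"
      using u unfolding proj_Cauchy_def by blast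
    have "norm (atensor_eval (u m) - atensor_eval (u n)) < e" if "m \<ge> N" "n \<ge> N" for m n
    proof -
      have "K * proj_norm (u m - u n) < e"
        using N[OF that] K(1) by (simp add: pos_less_divide_eq mult.commute)
      thus ?thesis using K(2)[of "u m - u n"] by (simp add: atensor_eval_diff)
    qed
    thus "\<exists>M. \<forall>m\<ge>M. \<forall>n\<ge>M. norm (atensor_eval (u m) - atensor_eval (u n)) < e" by blast
  qed
  thus ?thesis by (rule Cauchy_convergent)
qed

lemma ptensor_lift_exists: "\<exists>T. bounded_clinear T \<and> (\<forall>a b. T (tens a b) = \<phi> a b)"
proof -
  obtain K where K: "K > 0" "\<And>t. norm (atensor_eval t) \<le> K * proj_norm t"
    using atensor_eval_bound by blast
  define T where "T x = lim (\<lambda>n. atensor_eval (rep_ptensor x n))" for x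
  have T: "(\<lambda>n. atensor_eval (u n)) \<longlonglongrightarrow> T (abs_ptensor u)" if u: "proj_Cauchy u" for u
  proof -
    let ?v = "rep_ptensor (abs_ptensor u)"
    have "proj_equiv ?v u"
      by (rule Quotient3_rep_abs[OF Quotient3_ptensor]) (simp add: u)
    hence v: "proj_Cauchy ?v" and z: "(\<lambda>n. proj_norm (?v n - u n)) \<longlonglongrightarrow> 0"
      by (auto simp: proj_equiv_def)
    have "(\<lambda>n. K * proj_norm (?v n - u n)) \<longlonglongrightarrow> 0"
      using tendsto_mult_right_zero[OF z] .
    hence "(\<lambda>n. atensor_eval (?v n) - atensor_eval (u n)) \<longlonglongrightarrow> 0"
      by (rule Lim_null_comparison[rotated]) (simp add: K(2) flip: atensor_eval_diff)
    moreover have V: "(\<lambda>n. atensor_eval (?v n)) \<longlonglongrightarrow> T (abs_ptensor u)"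
      unfolding T_def using atensor_eval_convergent[OF v] by (simp add: convergent_LIMSEQ_iff)
    ultimately show ?thesis by (rule Lim_transform2[rotated])
  qed
  have Teq: "T (abs_ptensor u) = y" if "proj_Cauchy u" "(\<lambda>n. atensor_eval (u n)) \<longlonglongrightarrow> y" for u y
    using T[OF that(1)] that(2) by (rule LIMSEQ_unique)
  have add: "T (x + y) = T x + T y" for x y
  proof -
    obtain u where u: "proj_Cauchy u" "x = abs_ptensor u" by (rule ptensor_cases)
    obtain v where v: "proj_Cauchy v" "y = abs_ptensor v" by (rule ptensor_cases)
    have "T (abs_ptensor (\<lambda>n. u n + v n)) = T x + T y"
      unfolding u(2) v(2)
      by (rule Teq[OF proj_Cauchy_add[OF u(1) v(1)]]) (simp add: atensor_eval_add tendsto_add T u v)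
    thus ?thesis using u v by (simp add: abs_ptensor_simps)
  qed
  have scale: "T (c *\<^sub>C x) = c *\<^sub>C T x" for c x
  proof -
    obtain u where u: "proj_Cauchy u" "x = abs_ptensor u" by (rule ptensor_cases)
    have bl: "bounded_linear (\<lambda>y::'c. c *\<^sub>C y)"
    proof (rule bounded_linear_intro[where K = "cmod c"])
      show "c *\<^sub>C (r *\<^sub>R y) = r *\<^sub>R (c *\<^sub>C y)" for r and y :: 'c
        by (simp add: scaleR_scaleC scaleC_scaleC mult.commute)
    qed (auto simp: scaleC_add_right norm_scaleC mult.commute)
    have "T (abs_ptensor (\<lambda>n. c *\<^sub>C u n)) = c *\<^sub>C T x"
      unfolding u(2)
      by (rule Teq[OF proj_Cauchy_scale[OF u(1)]])
        (simp add: atensor_eval_scale bounded_linear.tendsto[OF bl T[OF u(1)]])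
    thus ?thesis using u by (simp add: abs_ptensor_simps)
  qed
  have bound: "norm (T x) \<le> norm x * K" for x
  proof -
    obtain u where u: "proj_Cauchy u" "x = abs_ptensor u" by (rule ptensor_cases)
    show ?thesis unfolding u(2)
    proof (rule LIMSEQ_le)
      show "(\<lambda>n. norm (atensor_eval (u n))) \<longlonglongrightarrow> norm (T (abs_ptensor u))"
        by (intro tendsto_norm T u)
      show "(\<lambda>n. proj_norm (u n) * K) \<longlonglongrightarrow> norm (abs_ptensor u) * K"
        by (intro tendsto_mult_right norm_abs_ptensor u)
    qed (use K(2) in \<open>auto simp: mult.commute\<close>)
  qed
  have "bounded_clinear T"
    unfolding bounded_clinear_def
  proof
    show "bounded_linear T"
      by (rule bounded_linear_intro[OF add _ bound]) (simp add: scaleR_scaleC scale)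
  qed (simp add: scale)
  moreover have "T (tens a b) = \<phi> a b" for a b
    unfolding tens_def by (rule Teq) (simp_all add: proj_Cauchy_const atensor_eval_atens)
  ultimately show ?thesis by blast
qed

end

lemma bounded_clinear_ptensor_eqI:
  fixes S T :: "('a::complex_normed_vector, 'b::complex_normed_vector) ptensor \<Rightarrow> 'c::complex_normed_vector"
  assumes S: "bounded_clinear S" and T: "bounded_clinear T"
    and eq: "\<And>a b. S (tens a b) = T (tens a b)"
  shows "S = T"
proof
  fix x :: "('a, 'b) ptensor"
  note lin = S[unfolded bounded_clinear_def, THEN conjunct1] T[unfolded bounded_clinear_def, THEN conjunct1]
  note lin' = lin[THEN bounded_linear.linear]
  have c: "S (abs_ptensor (\<lambda>_. t)) = T (abs_ptensor (\<lambda>_. t))" for t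
  proof (induction t rule: atensor_induct)
    case zero
    then show ?case using lin' by (simp add: linear_0 flip: zero_ptensor.abs_eq)
  next
    case (add a b t)
    have "abs_ptensor (\<lambda>_. atens a b + t) = tens a b + abs_ptensor (\<lambda>_. t)"
      by (simp add: tens_def abs_ptensor_simps proj_Cauchy_const)
    thus ?case using add eq by (simp add: lin'[THEN linear_add])
  qed
  obtain u where u: "proj_Cauchy u" "x = abs_ptensor u" by (rule ptensor_cases)
  have "(\<lambda>n. abs_ptensor (\<lambda>_. u n)) \<longlonglongrightarrow> x"
    unfolding LIMSEQ_iff
  proof (intro allI impI)
    fix e :: real assume "e > 0"
    then obtain N where N: "\<forall>n\<ge>N. norm (x - abs_ptensor (\<lambda>_. u n)) \<le> e / 2"
      using ptensor_approx[OF u(1), of "e / 2"] u(2) by auto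
    show "\<exists>N. \<forall>n\<ge>N. norm (abs_ptensor (\<lambda>_. u n) - x) < e"
    proof (intro exI allI impI)
      fix n assume "n \<ge> N"
      hence "norm (x - abs_ptensor (\<lambda>_. u n)) \<le> e / 2" using N by simp
      thus "norm (abs_ptensor (\<lambda>_. u n) - x) < e"
        using \<open>e > 0\<close> by (simp add: norm_minus_commute)
    qed
  qed
  from bounded_linear.tendsto[OF lin(1) this] bounded_linear.tendsto[OF lin(2) this]
  show "S x = T x" unfolding c by (rule LIMSEQ_unique)
qed

lemma ptensor_universal:
  fixes \<phi> :: "'a::complex_normed_vector \<Rightarrow> 'b::complex_normed_vector \<Rightarrow> 'c::complex_banach"
  assumes "bounded_cbilinear \<phi>"
  shows "\<exists>!T. bounded_clinear T \<and> (\<forall>a b. T (tens a b) = \<phi> a b)"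
  using ptensor_lift_exists[OF assms] bounded_clinear_ptensor_eqI by (metis (no_types, lifting))

lemma
  fixes \<phi> :: "'a::complex_normed_vector \<Rightarrow> 'b::complex_normed_vector \<Rightarrow> 'c::complex_banach"
  assumes "bounded_cbilinear \<phi>"
  shows bounded_clinear_ptensor_lift: "bounded_clinear (ptensor_lift \<phi>)"
    and ptensor_lift_tens: "ptensor_lift \<phi> (tens a b) = \<phi> a b"
  using theI'[OF ptensor_universal[OF assms]] unfolding ptensor_lift_def by auto

lemma norm_tens_le: "norm (tens a b) \<le> norm a * norm b"
proof -
  have "proj_norm (atens a b) \<le> norm a * norm b"
    using proj_norm_le[of "{#(a, b)#}"] by (simp add: atens.abs_eq)
  thus ?thesis by (simp add: tens_def norm_ptensor_const)
qed

lemma bounded_cbilinear_tens: "bounded_cbilinear tens"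
  unfolding bounded_cbilinear_def
proof (intro conjI allI)
  note s = tens_def abs_ptensor_simps proj_Cauchy_const atens_bilinear
  show sl: "tens (c *\<^sub>C a) b = c *\<^sub>C tens a b" for c and a :: 'a and b :: 'b
    by (simp add: s)
  show sr: "tens a (c *\<^sub>C b) = c *\<^sub>C tens a b" for c and a :: 'a and b :: 'b
    by (simp add: s)
  show "bounded_bilinear (tens :: 'a \<Rightarrow> 'b \<Rightarrow> _)"
  proof
    show "\<exists>K. \<forall>(a::'a) (b::'b). norm (tens a b) \<le> norm a * norm b * K"
      by (rule exI[of _ 1]) (simp add: norm_tens_le)
  qed (simp_all add: scaleR_scaleC sl sr, simp_all add: s)
qed


section \<open>Dual Banach algebras\<close>

subsection \<open>Weak and weak-star topologies\<close>

text \<open>The initial topology \<open>\<sigma>(X, \<Phi>)\<close>.\<close>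

definition sigma_topology :: "'x set \<Rightarrow> ('x \<Rightarrow> complex) set \<Rightarrow> 'x topology"
  where "sigma_topology X \<Phi> = topology_generated_by {{x\<in>X. f x \<in> U} |f U. f \<in> \<Phi> \<and> open U}"

definition weak_topology :: "'a::complex_normed_vector topology"
  where "weak_topology = sigma_topology UNIV (range cdual_apply)"

definition weak_star_topology :: "'a::complex_normed_vector cdual set \<Rightarrow> 'a topology"
  where "weak_star_topology Apre = sigma_topology UNIV (cdual_apply ` Apre)"

definition weak_star_on :: "'a::complex_normed_vector set \<Rightarrow> ('a \<Rightarrow> complex) topology"
  where "weak_star_on S = sigma_topology (dual_on S) {\<lambda>f. f x |x. x \<in> S}"

subsection \<open>Modules\<close>

text \<open>A bimodule structure is given by two maps \<open>l\<close>, \<open>r\<close> with \<open>l a x = a \<cdot> x\<close> and \<open>r a x = x \<cdot> a\<close>;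
  note the order of the arguments of \<open>r\<close>. The dual module has
  \<open>\<langle>x, a \<cdot> T\<rangle> = \<langle>x \<cdot> a, T\<rangle>\<close> and \<open>\<langle>x, T \<cdot> a\<rangle> = \<langle>a \<cdot> x, T\<rangle>\<close>.\<close>

definition dual_lact :: "('a \<Rightarrow> 'e \<Rightarrow> 'e::complex_normed_vector) \<Rightarrow> 'a \<Rightarrow> 'e cdual \<Rightarrow> 'e cdual"
  where "dual_lact r a T = cadjoint (r a) T"

definition dual_ract :: "('a \<Rightarrow> 'e \<Rightarrow> 'e::complex_normed_vector) \<Rightarrow> 'a \<Rightarrow> 'e cdual \<Rightarrow> 'e cdual"
  where "dual_ract l a T = cadjoint (l a) T"

definition dual_on_lact ::
    "'e::complex_normed_vector set \<Rightarrow> ('a \<Rightarrow> 'e \<Rightarrow> 'e) \<Rightarrow> 'a \<Rightarrow> ('e \<Rightarrow> complex) \<Rightarrow> 'e \<Rightarrow> complex"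
  where "dual_on_lact S r a n = zero_outside S (\<lambda>x. n (r a x))"

definition dual_on_ract ::
    "'e::complex_normed_vector set \<Rightarrow> ('a \<Rightarrow> 'e \<Rightarrow> 'e) \<Rightarrow> 'a \<Rightarrow> ('e \<Rightarrow> complex) \<Rightarrow> 'e \<Rightarrow> complex"
  where "dual_on_ract S l a n = zero_outside S (\<lambda>x. n (l a x))"

definition eval_on :: "'a::complex_normed_vector cdual set \<Rightarrow> 'a \<Rightarrow> 'a cdual \<Rightarrow> complex"
  where "eval_on Apre a = zero_outside Apre (\<lambda>f. cdual_apply f a)"

text \<open>The set \<open>Apre\<close> is the predual \<open>A\<^sub>*\<close>. The last two conjuncts say that \<open>A = (A\<^sub>*)\<^sup>*\<close>, isometrically,
  via the canonical map.\<close>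

definition dual_banach_algebra :: "'a::complex_banach_algebra cdual set \<Rightarrow> bool"
  where "dual_banach_algebra Apre \<longleftrightarrow> csubspace Apre \<and> closed Apre
    \<and> (\<forall>a. \<forall>f\<in>Apre. dual_lact (\<lambda>a x. x * a) a f \<in> Apre \<and> dual_ract (\<lambda>a x. a * x) a f \<in> Apre)
    \<and> bij_betw (eval_on Apre) UNIV (dual_on Apre)
    \<and> (\<forall>a. dual_norm_on Apre (eval_on Apre a) = norm a)"

text \<open>The identification of \<open>(A\<^sub>*)\<^sup>*\<close> with \<open>A\<close>.\<close>

definition of_predual_dual :: "'a::complex_normed_vector cdual set \<Rightarrow> ('a cdual \<Rightarrow> complex) \<Rightarrow> 'a"
  where "of_predual_dual Apre = inv (eval_on Apre)"

definition sigma_wc :: "'a::complex_banach_algebra cdual set \<Rightarrow> ('a \<Rightarrow> 'e \<Rightarrow> 'e) \<Rightarrow> ('a \<Rightarrow> 'e \<Rightarrow> 'e) \<Rightarrow>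
    'e::complex_normed_vector set"
  where "sigma_wc Apre l r = {x. continuous_map (weak_star_topology Apre) weak_topology (\<lambda>a. l a x)
    \<and> continuous_map (weak_star_topology Apre) weak_topology (\<lambda>a. r a x)}"

subsection \<open>The bimodule \<open>A \<otimes> A\<close> and its duals\<close>

definition pt_lact :: "'a::complex_banach_algebra \<Rightarrow> ('a, 'a) ptensor \<Rightarrow> ('a, 'a) ptensor"
  where "pt_lact a = ptensor_lift (\<lambda>b c. tens (a * b) c)"

definition pt_ract :: "'a::complex_banach_algebra \<Rightarrow> ('a, 'a) ptensor \<Rightarrow> ('a, 'a) ptensor"
  where "pt_ract a = ptensor_lift (\<lambda>b c. tens b (c * a))"

definition pt_mult :: "('a::complex_banach_algebra, 'a) ptensor \<Rightarrow> 'a"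
  where "pt_mult = ptensor_lift (*)"

definition pt_dual_lact :: "'a::complex_banach_algebra \<Rightarrow> ('a, 'a) ptensor cdual \<Rightarrow> ('a, 'a) ptensor cdual"
  where "pt_dual_lact = dual_lact pt_ract"

definition pt_dual_ract :: "'a::complex_banach_algebra \<Rightarrow> ('a, 'a) ptensor cdual \<Rightarrow> ('a, 'a) ptensor cdual"
  where "pt_dual_ract = dual_ract pt_lact"

definition pt_bidual_lact ::
    "'a::complex_banach_algebra \<Rightarrow> ('a, 'a) ptensor cdual cdual \<Rightarrow> ('a, 'a) ptensor cdual cdual"
  where "pt_bidual_lact = dual_lact pt_dual_ract"

definition pt_bidual_ract ::
    "'a::complex_banach_algebra \<Rightarrow> ('a, 'a) ptensor cdual cdual \<Rightarrow> ('a, 'a) ptensor cdual cdual"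
  where "pt_bidual_ract = dual_ract pt_dual_lact"

lemma bounded_cbilinear_tens_comp:
  assumes "bounded_clinear f" "bounded_clinear g"
  shows "bounded_cbilinear (\<lambda>a b. tens (f a) (g b))"
  using assms bounded_cbilinear_tens unfolding bounded_cbilinear_def bounded_clinear_def
  by (auto intro: bounded_bilinear.comp)

lemma bounded_clinear_mult:
  "bounded_clinear (\<lambda>x::'a::complex_banach_algebra. a * x)"
  "bounded_clinear (\<lambda>x::'a::complex_banach_algebra. x * a)"
  by (auto simp: bounded_clinear_def bounded_linear_mult_right bounded_linear_mult_left
      mult_scaleC_left mult_scaleC_right)

lemma bounded_clinear_id: "bounded_clinear (\<lambda>x. x)"
  by (simp add: bounded_clinear_def bounded_linear_ident)

lemma
  fixes a :: "'a::complex_banach_algebra"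
  shows bounded_clinear_pt_lact: "bounded_clinear (pt_lact a)"
    and pt_lact_tens: "pt_lact a (tens b c) = tens (a * b) c"
    and bounded_clinear_pt_ract: "bounded_clinear (pt_ract a)"
    and pt_ract_tens: "pt_ract a (tens b c) = tens b (c * a)"
proof -
  note l = bounded_cbilinear_tens_comp[OF bounded_clinear_mult(1)[of a] bounded_clinear_id]
  note r = bounded_cbilinear_tens_comp[OF bounded_clinear_id bounded_clinear_mult(2)[of a]]
  show "bounded_clinear (pt_lact a)" "pt_lact a (tens b c) = tens (a * b) c"
    using bounded_clinear_ptensor_lift[OF l] ptensor_lift_tens[OF l] by (simp_all add: pt_lact_def)
  show "bounded_clinear (pt_ract a)" "pt_ract a (tens b c) = tens b (c * a)"
    using bounded_clinear_ptensor_lift[OF r] ptensor_lift_tens[OF r] by (simp_all add: pt_ract_def)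
qed

lemma bounded_clinear_pt_mult: "bounded_clinear (pt_mult :: ('a::complex_banach_algebra, 'a) ptensor \<Rightarrow> 'a)"
  and pt_mult_tens: "pt_mult (tens a b) = a * (b :: 'a::complex_banach_algebra)"
proof -
  have m: "bounded_cbilinear ((*) :: 'a \<Rightarrow> 'a \<Rightarrow> 'a)"
    by (simp add: bounded_cbilinear_def bounded_bilinear_mult mult_scaleC_left mult_scaleC_right)
  show "bounded_clinear (pt_mult :: ('a, 'a) ptensor \<Rightarrow> 'a)" "pt_mult (tens a b) = (a * b :: 'a)"
    unfolding pt_mult_def by (rule bounded_clinear_ptensor_lift[OF m] ptensor_lift_tens[OF m])+
qed

definition sigma_wc_pt_dual :: "'a::complex_banach_algebra cdual set \<Rightarrow> ('a, 'a) ptensor cdual set"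
  where "sigma_wc_pt_dual Apre = sigma_wc Apre pt_dual_lact pt_dual_ract"

text \<open>The adjoint of the restriction of \<open>\<pi>\<^sup>*\<close> to a map from \<open>A\<^sub>*\<close> to \<open>\<sigma>wc((A \<otimes> A)\<^sup>*)\<close>, with values in
  \<open>(A\<^sub>*)\<^sup>* = A\<close>.\<close>

definition pi_sigma_wc ::
    "'a::complex_banach_algebra cdual set \<Rightarrow> (('a, 'a) ptensor cdual \<Rightarrow> complex) \<Rightarrow> 'a"
  where "pi_sigma_wc Apre n =
    of_predual_dual Apre (zero_outside Apre (\<lambda>f. n (cadjoint pt_mult f)))"

text \<open>The adjoint of the inclusion of \<open>A\<^sub>*\<close> into \<open>A\<^sup>*\<close>, with values in \<open>(A\<^sub>*)\<^sup>* = A\<close>.\<close>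

definition incl_adjoint :: "'a::complex_normed_vector cdual set \<Rightarrow> 'a cdual cdual \<Rightarrow> 'a"
  where "incl_adjoint Apre \<Phi> = of_predual_dual Apre (zero_outside Apre (cdual_apply \<Phi>))"


section \<open>Nets\<close>

definition directed_index :: "'i set \<Rightarrow> ('i \<Rightarrow> 'i \<Rightarrow> bool) \<Rightarrow> bool"
  where "directed_index I le \<longleftrightarrow> I \<noteq> {} \<and> (\<forall>i\<in>I. le i i)
    \<and> (\<forall>i\<in>I. \<forall>j\<in>I. \<forall>k\<in>I. le i j \<longrightarrow> le j k \<longrightarrow> le i k)
    \<and> (\<forall>i\<in>I. \<forall>j\<in>I. \<exists>k\<in>I. le i k \<and> le j k)"

definition net_filter :: "'i set \<Rightarrow> ('i \<Rightarrow> 'i \<Rightarrow> bool) \<Rightarrow> 'i filter"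
  where "net_filter I le = (INF i\<in>I. principal {j\<in>I. le i j})"

lemma eventually_net_filter:
  assumes "directed_index I le"
  shows "eventually P (net_filter I le) \<longleftrightarrow> (\<exists>i\<in>I. \<forall>j\<in>I. le i j \<longrightarrow> P j)"
proof -
  have "eventually P (net_filter I le) \<longleftrightarrow> (\<exists>i\<in>I. eventually P (principal {j\<in>I. le i j}))"
    unfolding net_filter_def
  proof (rule eventually_INF_base)
    show "I \<noteq> {}" using assms by (simp add: directed_index_def)
    fix i j assume ij: "i \<in> I" "j \<in> I"
    have dir: "\<exists>k\<in>I. le i k \<and> le j k" and
      tr: "\<And>x y z. x \<in> I \<Longrightarrow> y \<in> I \<Longrightarrow> z \<in> I \<Longrightarrow> le x y \<Longrightarrow> le y z \<Longrightarrow> le x z"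
      using assms ij unfolding directed_index_def by blast+
    from dir obtain k where k: "k \<in> I" "le i k" "le j k" by (elim bexE conjE)
    have "{l \<in> I. le k l} \<subseteq> {l \<in> I. le i l} \<inter> {l \<in> I. le j l}"
      using tr[OF ij(1) k(1) _ k(2)] tr[OF ij(2) k(1) _ k(3)] by blast
    then show "\<exists>x\<in>I. principal {j \<in> I. le x j} \<le> inf (principal {j' \<in> I. le i j'}) (principal {j' \<in> I. le j j'})"
      using k(1) by (intro bexI[of _ k]) simp_all
  qed
  thus ?thesis by (auto simp: eventually_principal)
qed

text \<open>Every net can be re-indexed, without affecting its values or its convergence, by a directed
  subset of \<open>'x \<times> 'x set\<close>, where \<open>'x\<close> is the type of its values: replace \<open>i\<close> by the pair of \<open>m i\<close> and
  the tail of \<open>m\<close> from \<open>i\<close> on. Hence the existential quantification over nets in the definitions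
  of amenability below can use this fixed index type.\<close>

lemma net_reindex:
  fixes m :: "'i \<Rightarrow> 'x"
  assumes I: "directed_index I le"
  obtains J :: "('x \<times> 'x set) set" and le' and m' :: "'x \<times> 'x set \<Rightarrow> 'x"
  where "directed_index J le'" "m' ` J \<subseteq> m ` I"
    "\<And>P. eventually (\<lambda>i. P (m i)) (net_filter I le) \<Longrightarrow> eventually (\<lambda>j. P (m' j)) (net_filter J le')"
proof -
  define tl where "tl i = m ` {j\<in>I. le i j}" for i
  let ?J = "(\<lambda>i. (m i, tl i)) ` I" and ?le = "\<lambda>p q. snd q \<subseteq> snd p"
  have refl: "\<And>i. i \<in> I \<Longrightarrow> le i i"
    and tr: "\<And>x y z. x \<in> I \<Longrightarrow> y \<in> I \<Longrightarrow> z \<in> I \<Longrightarrow> le x y \<Longrightarrow> le y z \<Longrightarrow> le x z"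
    and dir: "\<And>i j. i \<in> I \<Longrightarrow> j \<in> I \<Longrightarrow> \<exists>k\<in>I. le i k \<and> le j k"
    using I unfolding directed_index_def by blast+
  have tl: "tl k \<subseteq> tl i" if "i \<in> I" "k \<in> I" "le i k" for i k
    using that tr unfolding tl_def by blast
  have dJ: "directed_index ?J ?le"
    unfolding directed_index_def
  proof (intro conjI ballI impI)
    show "?J \<noteq> {}" using I by (simp add: directed_index_def)
    fix p q assume "p \<in> ?J" "q \<in> ?J"
    then obtain i j where ij: "i \<in> I" "p = (m i, tl i)" "j \<in> I" "q = (m j, tl j)" by blast
    obtain k where k: "k \<in> I" "le i k" "le j k" using dir ij by blast
    show "\<exists>k\<in>?J. ?le p k \<and> ?le q k"
      using tl k ij by (intro bexI[of _ "(m k, tl k)"]) auto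
  qed auto
  have img: "fst ` ?J \<subseteq> m ` I" by auto
  have ev: "eventually (\<lambda>j. P (fst j)) (net_filter ?J ?le)"
    if P: "eventually (\<lambda>i. P (m i)) (net_filter I le)" for P
  proof -
    obtain i where i: "i \<in> I" "\<And>j. j \<in> I \<Longrightarrow> le i j \<Longrightarrow> P (m j)"
      using P by (auto simp: eventually_net_filter[OF I])
    have *: "P (fst q)" if q: "q \<in> ?J" "?le (m i, tl i) q" for q
    proof -
      obtain j where j: "j \<in> I" "q = (m j, tl j)" using q(1) by blast
      hence "m j \<in> tl j" using refl by (auto simp: tl_def)
      hence "m j \<in> tl i" using q(2) j(2) by auto
      thus ?thesis using i(2) j(2) by (auto simp: tl_def)
    qed
    show ?thesis
      unfolding eventually_net_filter[OF dJ]
    proof (rule bexI[of _ "(m i, tl i)"])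
      show "(m i, tl i) \<in> ?J" using i(1) by (rule imageI)
    qed (intro ballI impI, rule *)
  qed
  show thesis by (rule that[OF dJ img ev])
qed


section \<open>Pseudo-Connes amenability\<close>

definition strong_pseudo_Connes_net ::
    "'a::complex_banach_algebra cdual set \<Rightarrow> 'i set \<Rightarrow> ('i \<Rightarrow> 'i \<Rightarrow> bool) \<Rightarrow>
      ('i \<Rightarrow> ('a, 'a) ptensor cdual \<Rightarrow> complex) \<Rightarrow> bool"
  where "strong_pseudo_Connes_net Apre I le m \<longleftrightarrow>
    (let S = sigma_wc_pt_dual Apre; \<pi> = pi_sigma_wc Apre in
      directed_index I le \<and> (\<forall>i\<in>I. m i \<in> dual_on S) \<and>
      (\<forall>a. limitin (weak_star_on S)
            (\<lambda>i x. dual_on_lact S pt_dual_ract a (m i) x - dual_on_ract S pt_dual_lact a (m i) x)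
            (\<lambda>x. 0) (net_filter I le) \<and>
          (\<forall>i\<in>I. a * \<pi> (m i) = \<pi> (m i) * a) \<and>
          limitin (weak_star_topology Apre) (\<lambda>i. a * \<pi> (m i)) a (net_filter I le)))"

definition strong_pseudo_Connes_amenable :: "'a::complex_banach_algebra cdual set \<Rightarrow> bool"
  where "strong_pseudo_Connes_amenable Apre \<longleftrightarrow>
    (\<exists>(I :: ((('a, 'a) ptensor cdual \<Rightarrow> complex) \<times> (('a, 'a) ptensor cdual \<Rightarrow> complex) set) set) le m.
      strong_pseudo_Connes_net Apre I le m)"

definition Johnson_pseudo_Connes_net ::
    "'a::complex_banach_algebra cdual set \<Rightarrow> 'i set \<Rightarrow> ('i \<Rightarrow> 'i \<Rightarrow> bool) \<Rightarrow>
      ('i \<Rightarrow> ('a, 'a) ptensor cdual cdual) \<Rightarrow> bool"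
  where "Johnson_pseudo_Connes_net Apre I le m \<longleftrightarrow>
    directed_index I le \<and>
    (\<forall>a. (\<forall>i\<in>I. \<forall>T\<in>sigma_wc_pt_dual Apre.
            cdual_apply (pt_bidual_lact a (m i)) T = cdual_apply (pt_bidual_ract a (m i)) T) \<and>
        ((\<lambda>i. incl_adjoint Apre (cadjoint (cadjoint pt_mult) (m i)) * a) \<longlongrightarrow> a) (net_filter I le))"

definition Johnson_pseudo_Connes_amenable :: "'a::complex_banach_algebra cdual set \<Rightarrow> bool"
  where "Johnson_pseudo_Connes_amenable Apre \<longleftrightarrow>
    (\<exists>(I :: (('a, 'a) ptensor cdual cdual \<times> ('a, 'a) ptensor cdual cdual set) set) le m.
      Johnson_pseudo_Connes_net Apre I le m)"

lemma strong_pseudo_Connes_amenableI: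
  fixes Apre :: "'a::complex_banach_algebra cdual set"
  assumes m: "strong_pseudo_Connes_net Apre I le m"
  shows "strong_pseudo_Connes_amenable Apre"
proof -
  have I: "directed_index I le" using m unfolding strong_pseudo_Connes_net_def Let_def by (elim conjE)
  show ?thesis
  proof (rule net_reindex[OF I, of m])
    fix J le'
      and m' :: "(('a, 'a) ptensor cdual \<Rightarrow> complex) \<times> (('a, 'a) ptensor cdual \<Rightarrow> complex) set \<Rightarrow> ('a, 'a) ptensor cdual \<Rightarrow> complex"
    assume J: "directed_index J le'" "m' ` J \<subseteq> m ` I"
      and ev: "\<And>P. eventually (\<lambda>i. P (m i)) (net_filter I le) \<Longrightarrow> eventually (\<lambda>j. P (m' j)) (net_filter J le')"
    have lim: "limitin X (\<lambda>i. h (m' i)) l (net_filter J le')"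
      if H: "limitin X (\<lambda>i. h (m i)) l (net_filter I le)" for X l and h :: "_ \<Rightarrow> 'z"
    proof -
      have "eventually (\<lambda>j. h (m' j) \<in> U) (net_filter J le')"
        if "eventually (\<lambda>i. h (m i) \<in> U) (net_filter I le)" for U
        using that by (rule ev)
      thus ?thesis using H unfolding limitin_def by blast
    qed
    have ball: "\<forall>j\<in>J. P (m' j)" if "\<forall>i\<in>I. P (m i)" for P
      using that J(2) by fastforce
    note mm = m[unfolded strong_pseudo_Connes_net_def Let_def, THEN conjunct2]
    have "strong_pseudo_Connes_net Apre J le' m'"
      unfolding strong_pseudo_Connes_net_def Let_def
    proof (intro conjI allI)
      fix a
      note c = mm[THEN conjunct2, THEN spec, of a]
      note c1 = c[THEN conjunct1] and c2 = c[THEN conjunct2, THEN conjunct1]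
        and c3 = c[THEN conjunct2, THEN conjunct2]
      show "limitin (weak_star_on (sigma_wc_pt_dual Apre))
          (\<lambda>i x. dual_on_lact (sigma_wc_pt_dual Apre) pt_dual_ract a (m' i) x -
            dual_on_ract (sigma_wc_pt_dual Apre) pt_dual_lact a (m' i) x)
          (\<lambda>x. 0) (net_filter J le')"
        by (rule lim[OF c1])
      show "\<forall>i\<in>J. a * pi_sigma_wc Apre (m' i) = pi_sigma_wc Apre (m' i) * a"
        by (rule ball[OF c2])
      show "limitin (weak_star_topology Apre) (\<lambda>i. a * pi_sigma_wc Apre (m' i)) a (net_filter J le')"
        by (rule lim[OF c3])
    qed (rule J(1), rule ball[OF mm[THEN conjunct1]])
    thus ?thesis unfolding strong_pseudo_Connes_amenable_def by blast
  qed
qed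

lemma Johnson_pseudo_Connes_amenableI:
  fixes Apre :: "'a::complex_banach_algebra cdual set"
  assumes m: "Johnson_pseudo_Connes_net Apre I le m"
  shows "Johnson_pseudo_Connes_amenable Apre"
proof -
  have I: "directed_index I le" using m unfolding Johnson_pseudo_Connes_net_def by (elim conjE)
  show ?thesis
  proof (rule net_reindex[OF I, of m])
    fix J le'
      and m' :: "('a, 'a) ptensor cdual cdual \<times> ('a, 'a) ptensor cdual cdual set \<Rightarrow> ('a, 'a) ptensor cdual cdual"
    assume J: "directed_index J le'" "m' ` J \<subseteq> m ` I"
      and ev: "\<And>P. eventually (\<lambda>i. P (m i)) (net_filter I le) \<Longrightarrow> eventually (\<lambda>j. P (m' j)) (net_filter J le')"
    have lim: "((\<lambda>i. h (m' i)) \<longlongrightarrow> l) (net_filter J le')"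
      if H: "((\<lambda>i. h (m i)) \<longlongrightarrow> l) (net_filter I le)" for l and h :: "_ \<Rightarrow> 'z::topological_space"
    proof -
      have "eventually (\<lambda>j. h (m' j) \<in> U) (net_filter J le')"
        if "eventually (\<lambda>i. h (m i) \<in> U) (net_filter I le)" for U
        using that by (rule ev)
      thus ?thesis using H unfolding tendsto_def by blast
    qed
    have ball: "\<forall>j\<in>J. P (m' j)" if "\<forall>i\<in>I. P (m i)" for P
      using that J(2) by fastforce
    have "Johnson_pseudo_Connes_net Apre J le' m'"
      unfolding Johnson_pseudo_Connes_net_def
    proof (intro conjI allI)
      fix a
      note c = m[unfolded Johnson_pseudo_Connes_net_def, THEN conjunct2, THEN spec, of a]
      note c1 = c[THEN conjunct1] and c2 = c[THEN conjunct2]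
      show "\<forall>i\<in>J. \<forall>T\<in>sigma_wc_pt_dual Apre.
          cdual_apply (pt_bidual_lact a (m' i)) T = cdual_apply (pt_bidual_ract a (m' i)) T"
        by (rule ball[OF c1])
      show "((\<lambda>i. incl_adjoint Apre (cadjoint (cadjoint pt_mult) (m' i)) * a) \<longlongrightarrow> a) (net_filter J le')"
        by (rule lim[OF c2])
    qed (rule J(1))
    thus ?thesis unfolding Johnson_pseudo_Connes_amenable_def by blast
  qed
qed

end

theory Submission
  imports Defs
begin

text \<open>
  Write \<open>S = \<sigma>wc((A \<otimes> A)\<^sup>*)\<close>. A Johnson net \<open>m\<close> lives in the bidual of \<open>A \<otimes> A\<close>; the strong net
  is its restriction \<open>n\<^sub>i = m\<^sub>i|S\<close>, an element of the dual of \<open>S\<close>. Two facts make this work.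

  Firstly, \<open>S\<close> is a sub-bimodule of \<open>(A \<otimes> A)\<^sup>*\<close> (\<open>csubspace_sigma_wc\<close>, \<open>sigma_wc_lact\<close>,
  \<open>sigma_wc_ract\<close>). So restriction to \<open>S\<close> commutes with the actions, and the Johnson condition
  \<open>\<langle>T, a \<cdot> m\<^sub>i\<rangle> = \<langle>T, m\<^sub>i \<cdot> a\<rangle>\<close> for \<open>T \<in> S\<close> says that \<open>a \<cdot> n\<^sub>i - n\<^sub>i \<cdot> a\<close> is not merely a null net
  but identically zero.

  Secondly, \<open>\<pi>\<^sup>*\<close> maps \<open>A\<^sub>*\<close> into \<open>S\<close> (\<open>cadjoint_pt_mult_in_sigma_wc\<close>). So the image of \<open>n\<^sub>i\<close> under
  \<open>\<pi>\<^sub>\<sigma>\<^sub>w\<^sub>c\<close> is the element of \<open>A\<close> that the Johnson condition calls \<open>i\<^sup>*\<pi>\<^sup>*\<^sup>*(m\<^sub>i)\<close>; call it \<open>p\<^sub>i\<close>. As \<open>\<pi>\<close> is a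
  bimodule map, \<open>p\<^sub>i\<close> inherits from \<open>n\<^sub>i\<close> that it commutes with \<open>A\<close>. Hence \<open>a p\<^sub>i = p\<^sub>i a\<close>, which tends
  to \<open>a\<close> in norm and a fortiori in the weak-star topology.
\<close>

section \<open>Initial topologies\<close>

text \<open>For empty \<open>\<Phi>\<close> the generating family is empty, and so is the space that it generates.\<close>

lemma topspace_sigma_topology:
  assumes "\<Phi> \<noteq> {}"
  shows "topspace (sigma_topology X \<Phi>) = X"
proof -
  obtain f where "f \<in> \<Phi>" using assms by blast
  hence "X \<in> {{x\<in>X. f x \<in> U} |f U. f \<in> \<Phi> \<and> open U}"
    by (intro CollectI exI[of _ f] exI[of _ UNIV]) auto
  thus ?thesis unfolding sigma_topology_def topology_generated_by_topspace by blast
qed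

lemma continuous_map_sigma_topology_functional:
  assumes "f \<in> \<Phi>"
  shows "continuous_map (sigma_topology X \<Phi>) euclidean f"
proof -
  have ts: "topspace (sigma_topology X \<Phi>) = X"
    using assms by (intro topspace_sigma_topology) blast
  have "openin (sigma_topology X \<Phi>) {x\<in>X. f x \<in> U}" if "open U" for U
    unfolding sigma_topology_def
    by (rule topology_generated_by_Basis) (use assms that in blast)
  thus ?thesis by (simp add: continuous_map_def ts)
qed

lemma continuous_map_into_sigma_topology:
  assumes "\<Phi> \<noteq> {}" and g: "\<And>t. t \<in> topspace T \<Longrightarrow> g t \<in> X"
    and cont: "\<And>f. f \<in> \<Phi> \<Longrightarrow> continuous_map T euclidean (\<lambda>t. f (g t))"
  shows "continuous_map T (sigma_topology X \<Phi>) g"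
  unfolding sigma_topology_def
proof (rule continuous_on_generated_topo)
  fix V assume "V \<in> {{x\<in>X. f x \<in> U} |f U. f \<in> \<Phi> \<and> open U}"
  then obtain f U where V: "V = {x\<in>X. f x \<in> U}" "f \<in> \<Phi>" "open U" by blast
  have "openin T {t \<in> topspace T. f (g t) \<in> U}"
    using cont[OF V(2)] V(3) by (simp add: continuous_map_def)
  also have "{t \<in> topspace T. f (g t) \<in> U} = g -` V \<inter> topspace T"
    using g V(1) by blast
  finally show "openin T (g -` V \<inter> topspace T)" .
next
  have "X = topspace (sigma_topology X \<Phi>)"
    using topspace_sigma_topology[OF assms(1)] by simp
  thus "g ` topspace T \<subseteq> \<Union> {{x\<in>X. f x \<in> U} |f U. f \<in> \<Phi> \<and> open U}"
    using g by (auto simp: sigma_topology_def)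
qed

lemma continuous_map_weak_topology_iff:
  fixes g :: "'t \<Rightarrow> 'a::complex_normed_vector"
  shows "continuous_map T weak_topology g \<longleftrightarrow>
    (\<forall>\<Psi>. continuous_map T euclidean (\<lambda>t. cdual_apply \<Psi> (g t)))"
proof
  assume g: "continuous_map T weak_topology g"
  have "continuous_map weak_topology euclidean (cdual_apply \<Psi>)" for \<Psi> :: "'a cdual"
    unfolding weak_topology_def by (rule continuous_map_sigma_topology_functional) simp
  from continuous_map_compose[OF g this]
  show "\<forall>\<Psi>. continuous_map T euclidean (\<lambda>t. cdual_apply \<Psi> (g t))"
    by (simp add: o_def)
next
  assume "\<forall>\<Psi>. continuous_map T euclidean (\<lambda>t. cdual_apply \<Psi> (g t))"
  thus "continuous_map T weak_topology g"
    unfolding weak_topology_def by (intro continuous_map_into_sigma_topology) auto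
qed

lemma norm_limit_imp_weak_star_limit:
  assumes "Apre \<noteq> {}" and lim: "(f \<longlongrightarrow> l) F"
  shows "limitin (weak_star_topology Apre) f l F"
proof -
  have "continuous_map euclidean (weak_star_topology Apre) (\<lambda>x. x)"
    unfolding weak_star_topology_def
    by (rule continuous_map_into_sigma_topology)
      (use assms(1) in \<open>auto intro: linear_continuous_on bounded_linear_cdual_apply\<close>)
  from continuous_map_limit[OF this, of f l F] lim show ?thesis by (simp add: o_def)
qed


section \<open>Functionals and their restrictions\<close>

lemma cdual_eqI: "(\<And>x. cdual_apply f x = cdual_apply g x) \<Longrightarrow> f = g"
  by (simp add: cdual_apply_inject[symmetric] fun_eq_iff)

lemma cdual_apply_add: "cdual_apply f (x + y) = cdual_apply f x + cdual_apply f y"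
  by (rule linear_add[OF bounded_linear.linear[OF bounded_linear_cdual_apply]])

lemma cdual_apply_scaleC: "cdual_apply f (c *\<^sub>C x) = c * cdual_apply f x"
  using cdual_apply[of f] by (simp add: bounded_clinear_def scaleC_complex_def)

lemma restriction_in_dual_on:
  assumes "csubspace S"
  shows "zero_outside S (cdual_apply f) \<in> dual_on S"
proof -
  have "cmod (cdual_apply f x) \<le> onorm (cdual_apply f) * norm x" for x
    by (rule onorm[OF bounded_linear_cdual_apply])
  thus ?thesis
    using assms
    by (auto simp: dual_on_def zero_outside_def csubspace_def cdual_apply_add cdual_apply_scaleC)
qed

lemma eval_on_of_predual_dual:
  assumes "dual_banach_algebra Apre" "g \<in> dual_on Apre"
  shows "eval_on Apre (of_predual_dual Apre g) = g"
proof -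
  have "range (eval_on Apre) = dual_on Apre"
    using assms(1) by (simp add: dual_banach_algebra_def bij_betw_def)
  thus ?thesis using assms(2) unfolding of_predual_dual_def by (intro f_inv_into_f) simp
qed

text \<open>The instance of \<open>(A\<^sub>*)\<^sup>* = A\<close> that is used throughout: on \<open>A\<^sub>*\<close>, every element of \<open>A\<^sup>*\<^sup>*\<close> is
  evaluation at a point of \<open>A\<close>.\<close>

lemma incl_adjoint_apply:
  assumes A: "dual_banach_algebra Apre" and f: "f \<in> Apre"
  shows "cdual_apply f (incl_adjoint Apre \<Phi>) = cdual_apply \<Phi> f"
proof -
  have "csubspace Apre" using A by (simp add: dual_banach_algebra_def)
  hence "eval_on Apre (incl_adjoint Apre \<Phi>) = zero_outside Apre (cdual_apply \<Phi>)"
    unfolding incl_adjoint_def by (intro eval_on_of_predual_dual[OF A] restriction_in_dual_on)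
  from fun_cong[OF this, of f] show ?thesis using f by (simp add: eval_on_def zero_outside_def)
qed

lemma predual_separates_points:
  assumes A: "dual_banach_algebra Apre"
    and eq: "\<And>f. f \<in> Apre \<Longrightarrow> cdual_apply f x = cdual_apply f y"
  shows "x = y"
proof -
  have "inj (eval_on Apre)" using A by (simp add: dual_banach_algebra_def bij_betw_def)
  moreover have "eval_on Apre x = eval_on Apre y"
    using eq by (auto simp: eval_on_def zero_outside_def)
  ultimately show ?thesis by (simp add: inj_eq)
qed


section \<open>Weak-star continuity and the submodule of weakly continuous elements\<close>

lemma predual_functional_continuous:
  "f \<in> Apre \<Longrightarrow> continuous_map (weak_star_topology Apre) euclidean (cdual_apply f)"
  unfolding weak_star_topology_def by (rule continuous_map_sigma_topology_functional) simp

lemma cdual_apply_mult_actions: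
  fixes a x :: "'a::complex_banach_algebra"
  shows "cdual_apply (dual_lact (\<lambda>a x. x * a) a f) x = cdual_apply f (x * a)"
    and "cdual_apply (dual_ract (\<lambda>a x. a * x) a f) x = cdual_apply f (a * x)"
  by (simp_all add: dual_lact_def dual_ract_def cdual_apply_cadjoint bounded_clinear_mult)

text \<open>Multiplication in a dual Banach algebra is separately weak-star continuous, because the
  functionals \<open>x \<mapsto> \<langle>a x, f\<rangle>\<close> and \<open>x \<mapsto> \<langle>x a, f\<rangle>\<close> are \<open>f \<cdot> a\<close> and \<open>a \<cdot> f\<close>, which lie in the predual
  when \<open>f\<close> does.\<close>

lemma weak_star_continuous_mult:
  assumes A: "dual_banach_algebra Apre"
  shows "continuous_map (weak_star_topology Apre) (weak_star_topology Apre) (\<lambda>x. a * x)"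
    and "continuous_map (weak_star_topology Apre) (weak_star_topology Apre) (\<lambda>x. x * a)"
proof -
  have ne: "cdual_apply ` Apre \<noteq> {}"
    using A by (auto simp: dual_banach_algebra_def csubspace_def)
  have mem: "dual_lact (\<lambda>a x. x * a) a f \<in> Apre" "dual_ract (\<lambda>a x. a * x) a f \<in> Apre"
    if "f \<in> Apre" for f
    using A that by (auto simp: dual_banach_algebra_def)
  have c: "continuous_map (weak_star_topology Apre) euclidean (\<lambda>x. cdual_apply f (a * x))"
    "continuous_map (weak_star_topology Apre) euclidean (\<lambda>x. cdual_apply f (x * a))"
    if "f \<in> Apre" for f
    using predual_functional_continuous[OF mem(2)[OF that]]
      predual_functional_continuous[OF mem(1)[OF that]]
    unfolding cdual_apply_mult_actions[abs_def] by blast+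
  show "continuous_map (weak_star_topology Apre) (weak_star_topology Apre) (\<lambda>x. a * x)"
    and "continuous_map (weak_star_topology Apre) (weak_star_topology Apre) (\<lambda>x. x * a)"
    using c by (subst (2) weak_star_topology_def, intro continuous_map_into_sigma_topology ne; auto)+
qed

lemma sigma_wc_iff:
  "x \<in> sigma_wc Apre l r \<longleftrightarrow>
    (\<forall>\<Psi>. continuous_map (weak_star_topology Apre) euclidean (\<lambda>a. cdual_apply \<Psi> (l a x)) \<and>
         continuous_map (weak_star_topology Apre) euclidean (\<lambda>a. cdual_apply \<Psi> (r a x)))"
  by (auto simp: sigma_wc_def continuous_map_weak_topology_iff)

lemma csubspace_sigma_wc:
  assumes l: "\<And>a. bounded_clinear (l a)" and r: "\<And>a. bounded_clinear (r a)"
  shows "csubspace (sigma_wc Apre l r)"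
proof -
  have add: "l a (x + y) = l a x + l a y" "r a (x + y) = r a x + r a y" for a x y
    using l[of a] r[of a] by (simp_all add: bounded_clinear_def bounded_linear.linear linear_add)
  have scale: "l a (c *\<^sub>C x) = c *\<^sub>C l a x" "r a (c *\<^sub>C x) = c *\<^sub>C r a x" for a c x
    using l[of a] r[of a] by (simp_all add: bounded_clinear_def)
  have zero: "l a 0 = 0" "r a 0 = 0" for a
    using l[of a] r[of a] by (simp_all add: bounded_clinear_def bounded_linear.linear linear_0)
  have mult: "continuous_map T euclidean (\<lambda>t. c * h t)"
    if "continuous_map T euclidean h" for T :: "'a topology" and h :: "'a \<Rightarrow> complex" and c
  proof -
    have "continuous_map euclidean euclidean (\<lambda>z. c * z)"
      by (simp add: continuous_on_mult_left)
    from continuous_map_compose[OF that this] show ?thesis by (simp add: o_def)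
  qed
  have "cdual_apply \<Psi> 0 = 0" for \<Psi> :: "'b cdual"
    using cdual_apply_scaleC[of \<Psi> 0 0] by (simp add: scaleC_zero_left)
  thus ?thesis
    by (auto simp: csubspace_def sigma_wc_iff add scale zero cdual_apply_add cdual_apply_scaleC
        intro!: continuous_map_add mult)
qed

text \<open>For a fixed \<open>a\<close>, the map \<open>b \<mapsto> b \<cdot> (a \<cdot> x) = (b a) \<cdot> x\<close> is weak-star to weak continuous by the
  continuity of multiplication in \<open>A\<close>, and \<open>b \<mapsto> (a \<cdot> x) \<cdot> b = a \<cdot> (x \<cdot> b)\<close> is so because the bounded
  operator \<open>a \<cdot> _\<close> is weakly continuous.\<close>

lemma sigma_wc_lact:
  assumes A: "dual_banach_algebra Apre" and l: "bounded_clinear (l a)"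
    and assoc: "\<And>b. l b (l a x) = l (b * a) x" "\<And>b. r b (l a x) = l a (r b x)"
    and x: "x \<in> sigma_wc Apre l r"
  shows "l a x \<in> sigma_wc Apre l r"
proof -
  let ?w = "weak_star_topology Apre"
  have "continuous_map ?w euclidean (\<lambda>b. cdual_apply \<Psi> (l (b * a) x))" for \<Psi>
    using continuous_map_compose[OF weak_star_continuous_mult(2)[OF A, of a],
        of euclidean "\<lambda>b. cdual_apply \<Psi> (l b x)"] x
    by (simp add: sigma_wc_iff o_def)
  moreover have "continuous_map ?w euclidean (\<lambda>b. cdual_apply \<Psi> (l a (r b x)))" for \<Psi>
    using x by (simp add: sigma_wc_iff flip: cdual_apply_cadjoint[OF l])
  ultimately show ?thesis by (simp add: sigma_wc_iff assoc)
qed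

lemma sigma_wc_ract:
  assumes A: "dual_banach_algebra Apre" and r: "bounded_clinear (r a)"
    and assoc: "\<And>b. r b (r a x) = r (a * b) x" "\<And>b. l b (r a x) = r a (l b x)"
    and x: "x \<in> sigma_wc Apre l r"
  shows "r a x \<in> sigma_wc Apre l r"
proof -
  let ?w = "weak_star_topology Apre"
  have "continuous_map ?w euclidean (\<lambda>b. cdual_apply \<Psi> (r (a * b) x))" for \<Psi>
    using continuous_map_compose[OF weak_star_continuous_mult(1)[OF A, of a],
        of euclidean "\<lambda>b. cdual_apply \<Psi> (r b x)"] x
    by (simp add: sigma_wc_iff o_def)
  moreover have "continuous_map ?w euclidean (\<lambda>b. cdual_apply \<Psi> (r a (l b x)))" for \<Psi>
    using x by (simp add: sigma_wc_iff flip: cdual_apply_cadjoint[OF r])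
  ultimately show ?thesis by (simp add: sigma_wc_iff assoc)
qed


section \<open>The projective tensor square and its dual\<close>

lemma bounded_clinear_compose:
  "bounded_clinear f \<Longrightarrow> bounded_clinear g \<Longrightarrow> bounded_clinear (\<lambda>x. f (g x))"
  by (auto simp: bounded_clinear_def intro: bounded_linear_compose)

lemma pt_bimodule:
  fixes a b :: "'a::complex_banach_algebra"
  shows "pt_lact (a * b) x = pt_lact a (pt_lact b x)"
    and "pt_ract (a * b) x = pt_ract b (pt_ract a x)"
    and "pt_ract b (pt_lact a x) = pt_lact a (pt_ract b x)"
proof -
  note l = bounded_clinear_pt_lact and r = bounded_clinear_pt_ract
  show "pt_lact (a * b) x = pt_lact a (pt_lact b x)"
    by (rule fun_cong[OF bounded_clinear_ptensor_eqI[OF l bounded_clinear_compose[OF l l]]])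
      (simp add: pt_lact_tens mult.assoc)
  show "pt_ract (a * b) x = pt_ract b (pt_ract a x)"
    by (rule fun_cong[OF bounded_clinear_ptensor_eqI[OF r bounded_clinear_compose[OF r r]]])
      (simp add: pt_ract_tens mult.assoc)
  show "pt_ract b (pt_lact a x) = pt_lact a (pt_ract b x)"
    by (rule fun_cong[OF bounded_clinear_ptensor_eqI[OF bounded_clinear_compose[OF r l]
            bounded_clinear_compose[OF l r]]])
      (simp add: pt_ract_tens pt_lact_tens)
qed

lemma pt_mult_module_map:
  fixes a :: "'a::complex_banach_algebra"
  shows "pt_mult (pt_lact a x) = a * pt_mult x"
    and "pt_mult (pt_ract a x) = pt_mult x * a"
proof -
  note m = bounded_clinear_pt_mult
  show "pt_mult (pt_lact a x) = a * pt_mult x"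
    by (rule fun_cong[OF bounded_clinear_ptensor_eqI[
            OF bounded_clinear_compose[OF m bounded_clinear_pt_lact]
              bounded_clinear_compose[OF bounded_clinear_mult(1) m]]])
      (simp add: pt_lact_tens pt_mult_tens mult.assoc)
  show "pt_mult (pt_ract a x) = pt_mult x * a"
    by (rule fun_cong[OF bounded_clinear_ptensor_eqI[
            OF bounded_clinear_compose[OF m bounded_clinear_pt_ract]
              bounded_clinear_compose[OF bounded_clinear_mult(2) m]]])
      (simp add: pt_ract_tens pt_mult_tens mult.assoc)
qed

lemma cdual_apply_pt_dual_actions:
  "cdual_apply (pt_dual_lact a T) x = cdual_apply T (pt_ract a x)"
  "cdual_apply (pt_dual_ract a T) x = cdual_apply T (pt_lact a x)"
  by (simp_all add: pt_dual_lact_def pt_dual_ract_def dual_lact_def dual_ract_def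
      cdual_apply_cadjoint bounded_clinear_pt_lact bounded_clinear_pt_ract)

lemma bounded_clinear_pt_dual_actions:
  "bounded_clinear (pt_dual_lact a)" "bounded_clinear (pt_dual_ract a)"
  unfolding pt_dual_lact_def pt_dual_ract_def dual_lact_def[abs_def] dual_ract_def[abs_def]
  by (intro bounded_clinear_cadjoint bounded_clinear_pt_lact bounded_clinear_pt_ract)+

lemma pt_dual_bimodule:
  "pt_dual_lact b (pt_dual_lact a T) = pt_dual_lact (b * a) T"
  "pt_dual_ract b (pt_dual_ract a T) = pt_dual_ract (a * b) T"
  "pt_dual_ract b (pt_dual_lact a T) = pt_dual_lact a (pt_dual_ract b T)"
  by (rule cdual_eqI; simp add: cdual_apply_pt_dual_actions pt_bimodule)+

lemma cadjoint_pt_mult_module_map: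
  "cadjoint pt_mult (dual_lact (\<lambda>a x. x * a) a f) = pt_dual_lact a (cadjoint pt_mult f)"
  "cadjoint pt_mult (dual_ract (\<lambda>a x. a * x) a f) = pt_dual_ract a (cadjoint pt_mult f)"
  by (rule cdual_eqI; simp add: cdual_apply_pt_dual_actions cdual_apply_mult_actions
      cdual_apply_cadjoint bounded_clinear_pt_mult pt_mult_module_map)+

lemma csubspace_sigma_wc_pt_dual: "csubspace (sigma_wc_pt_dual Apre)"
  unfolding sigma_wc_pt_dual_def
  by (intro csubspace_sigma_wc bounded_clinear_pt_dual_actions)

lemma sigma_wc_pt_dual_submodule:
  assumes "dual_banach_algebra Apre" "T \<in> sigma_wc_pt_dual Apre"
  shows "pt_dual_lact a T \<in> sigma_wc_pt_dual Apre" "pt_dual_ract a T \<in> sigma_wc_pt_dual Apre"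
  using assms unfolding sigma_wc_pt_dual_def
  by (auto intro!: sigma_wc_lact sigma_wc_ract bounded_clinear_pt_dual_actions
      simp: pt_dual_bimodule)

text \<open>The reason is that \<open>a \<mapsto> a \<cdot> f\<close> stays in the predual. For \<open>\<Psi>\<close> in the bidual of \<open>A \<otimes> A\<close>,
  \<open>\<Psi> \<circ> \<pi>\<^sup>*\<close> is an element of \<open>A\<^sup>*\<^sup>*\<close>, so on the predual it is evaluation at some \<open>c \<in> A\<close>. Therefore
  \<open>\<langle>\<Psi>, a \<cdot> \<pi>\<^sup>* f\<rangle> = \<langle>\<Psi>, \<pi>\<^sup>*(a \<cdot> f)\<rangle> = \<langle>c, a \<cdot> f\<rangle> = \<langle>c a, f\<rangle>\<close>, which is weak-star continuous in \<open>a\<close>.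
  The right action is symmetric.\<close>

lemma cadjoint_pt_mult_in_sigma_wc:
  assumes A: "dual_banach_algebra Apre" and f: "f \<in> Apre"
  shows "cadjoint pt_mult f \<in> sigma_wc_pt_dual Apre"
proof -
  let ?w = "weak_star_topology Apre"
  have bc: "bounded_clinear (cadjoint (pt_mult :: ('a, 'a) ptensor \<Rightarrow> 'a))"
    by (intro bounded_clinear_cadjoint bounded_clinear_pt_mult)
  have "continuous_map ?w euclidean (\<lambda>a. cdual_apply \<Psi> (pt_dual_lact a (cadjoint pt_mult f)))"
    "continuous_map ?w euclidean (\<lambda>a. cdual_apply \<Psi> (pt_dual_ract a (cadjoint pt_mult f)))" for \<Psi>
  proof -
    define c where "c = incl_adjoint Apre (cadjoint (cadjoint pt_mult) \<Psi>)"
    have c: "cdual_apply \<Psi> (cadjoint pt_mult g) = cdual_apply g c" if "g \<in> Apre" for g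
      by (simp add: c_def incl_adjoint_apply[OF A that] cdual_apply_cadjoint[OF bc])
    have mem: "dual_lact (\<lambda>a x. x * a) a f \<in> Apre" "dual_ract (\<lambda>a x. a * x) a f \<in> Apre" for a
      using A f by (auto simp: dual_banach_algebra_def)
    have "cdual_apply \<Psi> (pt_dual_lact a (cadjoint pt_mult f)) = cdual_apply f (c * a)"
      "cdual_apply \<Psi> (pt_dual_ract a (cadjoint pt_mult f)) = cdual_apply f (a * c)" for a
      by (simp_all add: c[OF mem(1)] c[OF mem(2)] cdual_apply_mult_actions
          flip: cadjoint_pt_mult_module_map)
    thus "continuous_map ?w euclidean (\<lambda>a. cdual_apply \<Psi> (pt_dual_lact a (cadjoint pt_mult f)))"
      "continuous_map ?w euclidean (\<lambda>a. cdual_apply \<Psi> (pt_dual_ract a (cadjoint pt_mult f)))"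
      using continuous_map_compose[OF weak_star_continuous_mult(1)[OF A, of c]
          predual_functional_continuous[OF f]]
        continuous_map_compose[OF weak_star_continuous_mult(2)[OF A, of c]
          predual_functional_continuous[OF f]]
      by (simp_all add: o_def)
  qed
  thus ?thesis by (simp add: sigma_wc_pt_dual_def sigma_wc_iff)
qed


section \<open>Restricting a Johnson net\<close>

lemma pi_sigma_wc_restriction:
  assumes "dual_banach_algebra Apre"
  shows "pi_sigma_wc Apre (zero_outside (sigma_wc_pt_dual Apre) (cdual_apply m)) =
    incl_adjoint Apre (cadjoint (cadjoint pt_mult) m)"
proof -
  have "bounded_clinear (cadjoint (pt_mult :: ('a, 'a) ptensor \<Rightarrow> 'a))"
    by (intro bounded_clinear_cadjoint bounded_clinear_pt_mult)
  hence "zero_outside Apre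
      (\<lambda>f. zero_outside (sigma_wc_pt_dual Apre) (cdual_apply m) (cadjoint pt_mult f)) =
    zero_outside Apre (cdual_apply (cadjoint (cadjoint pt_mult) m))"
    using cadjoint_pt_mult_in_sigma_wc[OF assms]
    by (auto simp: zero_outside_def fun_eq_iff cdual_apply_cadjoint)
  thus ?thesis by (simp add: pi_sigma_wc_def incl_adjoint_def)
qed

text \<open>Tested against \<open>f\<close> in the predual, both products become values of \<open>m\<close>:
  \<open>\<langle>a p, f\<rangle> = \<langle>m, \<pi>\<^sup>* f \<cdot> a\<rangle>\<close> and \<open>\<langle>p a, f\<rangle> = \<langle>m, a \<cdot> \<pi>\<^sup>* f\<rangle>\<close>, where \<open>p\<close> is the image of \<open>m\<close> in \<open>A\<close>.
  Since \<open>\<pi>\<^sup>* f\<close> is weakly continuous, the hypothesis applies to it.\<close>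

lemma incl_adjoint_commutes:
  assumes A: "dual_banach_algebra Apre"
    and m: "\<And>T. T \<in> sigma_wc_pt_dual Apre \<Longrightarrow>
      cdual_apply m (pt_dual_ract a T) = cdual_apply m (pt_dual_lact a T)"
  shows "a * incl_adjoint Apre (cadjoint (cadjoint pt_mult) m) =
    incl_adjoint Apre (cadjoint (cadjoint pt_mult) m) * a"
proof (rule predual_separates_points[OF A])
  fix f assume f: "f \<in> Apre"
  let ?p = "incl_adjoint Apre (cadjoint (cadjoint pt_mult) m)"
  have bc: "bounded_clinear (cadjoint (pt_mult :: ('a, 'a) ptensor \<Rightarrow> 'a))"
    by (intro bounded_clinear_cadjoint bounded_clinear_pt_mult)
  have p: "cdual_apply g ?p = cdual_apply m (cadjoint pt_mult g)" if "g \<in> Apre" for g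
    by (simp add: incl_adjoint_apply[OF A that] cdual_apply_cadjoint[OF bc])
  have mem: "dual_lact (\<lambda>a x. x * a) a f \<in> Apre" "dual_ract (\<lambda>a x. a * x) a f \<in> Apre"
    using A f by (auto simp: dual_banach_algebra_def)
  have "cdual_apply f (a * ?p) = cdual_apply m (pt_dual_ract a (cadjoint pt_mult f))"
    using p[OF mem(2)] by (simp add: cdual_apply_mult_actions cadjoint_pt_mult_module_map)
  also have "\<dots> = cdual_apply m (pt_dual_lact a (cadjoint pt_mult f))"
    by (rule m[OF cadjoint_pt_mult_in_sigma_wc[OF A f]])
  also have "\<dots> = cdual_apply f (?p * a)"
    using p[OF mem(1)] by (simp add: cdual_apply_mult_actions cadjoint_pt_mult_module_map)
  finally show "cdual_apply f (a * ?p) = cdual_apply f (?p * a)" .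
qed

lemma Johnson_net_restriction:
  fixes m :: "'i \<Rightarrow> ('a::complex_banach_algebra, 'a) ptensor cdual cdual"
  assumes A: "dual_banach_algebra Apre" and net: "Johnson_pseudo_Connes_net Apre I le m"
  shows "strong_pseudo_Connes_net Apre I le
    (\<lambda>i. zero_outside (sigma_wc_pt_dual Apre) (cdual_apply (m i)))"
proof -
  let ?S = "sigma_wc_pt_dual Apre"
  let ?n = "\<lambda>i. zero_outside ?S (cdual_apply (m i))"
  let ?p = "\<lambda>i. incl_adjoint Apre (cadjoint (cadjoint pt_mult) (m i))"
  have I: "directed_index I le" using net by (simp add: Johnson_pseudo_Connes_net_def)
  have "I \<noteq> {}" using I by (simp add: directed_index_def)
  hence in_I: "eventually (\<lambda>i. i \<in> I) (net_filter I le)"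
    unfolding eventually_net_filter[OF I] by blast
  have comm: "cdual_apply (m i) (pt_dual_ract a T) = cdual_apply (m i) (pt_dual_lact a T)"
    if "i \<in> I" "T \<in> ?S" for i a T
  proof -
    have "cdual_apply (pt_bidual_lact a (m i)) T = cdual_apply (pt_bidual_ract a (m i)) T"
      using net that unfolding Johnson_pseudo_Connes_net_def by blast
    thus ?thesis
      by (simp add: pt_bidual_lact_def pt_bidual_ract_def dual_lact_def dual_ract_def
          cdual_apply_cadjoint bounded_clinear_pt_dual_actions)
  qed
  have zero: "(\<lambda>x. dual_on_lact ?S pt_dual_ract a (?n i) x - dual_on_ract ?S pt_dual_lact a (?n i) x)
      = (\<lambda>x. 0)" if "i \<in> I" for i a
    using comm[OF that] sigma_wc_pt_dual_submodule[OF A]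
    by (auto simp: dual_on_lact_def dual_on_ract_def zero_outside_def)
  have zero_limit: "limitin (weak_star_on ?S)
      (\<lambda>i x. dual_on_lact ?S pt_dual_ract a (?n i) x - dual_on_ract ?S pt_dual_lact a (?n i) x)
      (\<lambda>x. 0) (net_filter I le)" for a
  proof -
    have "0 \<in> ?S" using csubspace_sigma_wc_pt_dual[of Apre] by (simp add: csubspace_def)
    hence "topspace (weak_star_on ?S) = dual_on ?S"
      unfolding weak_star_on_def by (intro topspace_sigma_topology) blast
    moreover have "(\<lambda>x. 0) \<in> dual_on ?S" by (auto simp: dual_on_def intro: exI[of _ 0])
    ultimately show ?thesis
      unfolding limitin_def
      by (auto intro: eventually_mono[OF in_I] simp: zero)
  qed
  have pi: "pi_sigma_wc Apre (?n i) = ?p i" for i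
    by (rule pi_sigma_wc_restriction[OF A])
  have p_comm: "a * ?p i = ?p i * a" if "i \<in> I" for i a
    by (rule incl_adjoint_commutes[OF A comm[OF that]])
  have p_limit: "limitin (weak_star_topology Apre) (\<lambda>i. a * ?p i) a (net_filter I le)" for a
  proof (rule norm_limit_imp_weak_star_limit)
    show "Apre \<noteq> {}" using A by (auto simp: dual_banach_algebra_def csubspace_def)
    have "((\<lambda>i. ?p i * a) \<longlongrightarrow> a) (net_filter I le)"
      using net by (simp add: Johnson_pseudo_Connes_net_def)
    thus "((\<lambda>i. a * ?p i) \<longlongrightarrow> a) (net_filter I le)"
      by (rule Lim_transform_eventually) (auto intro: eventually_mono[OF in_I] simp: p_comm)
  qed
  show ?thesis
    unfolding strong_pseudo_Connes_net_def Let_def pi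
    by (intro conjI allI ballI I restriction_in_dual_on csubspace_sigma_wc_pt_dual zero_limit
        p_comm p_limit)
qed

theorem proposition2p4:
  fixes Apre :: "'a::complex_banach_algebra cdual set"
  assumes "dual_banach_algebra Apre"
    and "Johnson_pseudo_Connes_amenable Apre"
  shows "strong_pseudo_Connes_amenable Apre"
  using assms Johnson_net_restriction strong_pseudo_Connes_amenableI
  unfolding Johnson_pseudo_Connes_amenable_def by blast

end
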